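(* Let $t$ be a prime power, $q=t^2$, and let $\mathcal{X}\subset\mathbb{P}^4(\mathbb{F}_q)$ be the non-degenerate hermitian variety $x_0^{t+1}+x_1^{t+1}+x_2^{t+1}+x_3^{t+1}+x_4^{t+1}=0$. The third weight of the code $C_2(\mathcal{X})$ is $t^7-t^5-t^2$. The codewords of third weight are exactly the codewords $c(f)$ for which the quadric $Z(f)$ is a pair of hyperplanes (over $\mathbb{F}_q$), one tangent to $\mathcal{X}$ and the other non-tangent to $\mathcal{X}$, such that the plane of intersection of the two hyperplanes intersects $\mathcal{X}$ in a non-singular hermitian plane curve.
   Context: Functional code: let $\mathcal{F}_2$ be the $\mathbb{F}_q$-vector space of forms of degree 2 in $x_0,\dots,x_4$ (with $0$). The code $C_2(\mathcal{X})$ is the image of the linear map $c:\mathcal{F}_2\to\mathbb{F}_q^{|\mathcal{X}|}$, $c(f)=(c_x(f))_{x\in\mathcal{X}(\mathbb{F}_q)}$, where $c_x(f)=f(x_0,\dots,x_4)/x_i^2$ for $x=(x_0:\dots:x_4)$ and $i$ the smallest index with $x_i\ne0$. The weight of $c(f)$ is $\#\mathcal{X}(\mathbb{F}_q)-\#(\mathcal{X}\cap Z(f))(\mathbb{F}_q)$, where $Z(f)$ is the zero set of $f$ in $\mathbb{P}^4(\mathbb{F}_q)$. The $i$-th weight of the code is the $i$-th smallest value among the weights of nonzero codewords. A hyperplane is tangent to $\mathcal{X}$ if it is the tangent hyperplane $\sum_i p_i^t x_i=0$ at some point $P=(p_0:\dots:p_4)$ of $\mathcal{X}$. The intersection of $\mathcal{X}$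 with a plane is a hermitian plane curve; it is non-singular if the restricted hermitian form has rank 3. *)

theory Defs
  imports
    "HOL-Analysis.Analysis"
    "HOL-Library.Poly_Mapping"
    "HOL-Number_Theory.Prime_Powers"
begin

section \<open>The projective space of dimension 4\<close>

text \<open>
  The coordinates \<open>x\<^sub>0, \<dots>, x\<^sub>4\<close> are indexed by the five-element type \<open>5\<close>, whose elements are
  \<open>0 < 1 < 2 < 3 < 4\<close>. A point is a one-dimensional subspace, given as a set of vectors; the nonzero
  elements of a point are its homogeneous coordinate vectors.
\<close>

definition PG4 :: "('a::field ^ 5) set set" where
  "PG4 = {vec.span {v} | v. v \<noteq> 0}"

definition hyperplane :: "('a::field ^ 5) set set \<Rightarrow> bool" where
  "hyperplane H \<longleftrightarrow>
     (\<exists>a. a \<noteq> 0 \<and> H = {x \<in> PG4. \<forall>v\<in>x. (\<Sum>i\<in>UNIV. a $ i * v $ i) = 0})"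

section \<open>Quadratic forms\<close>

text \<open>
  Polynomials are finitely supported families of coefficients indexed by exponent vectors
  \<open>5 \<Rightarrow>\<^sub>0 nat\<close>.
\<close>

type_synonym 'a poly5 = "(5 \<Rightarrow>\<^sub>0 nat) \<Rightarrow>\<^sub>0 'a"

definition eval_poly5 :: "'a::field poly5 \<Rightarrow> 'a ^ 5 \<Rightarrow> 'a" where
  "eval_poly5 f v =
     (\<Sum>m\<in>Poly_Mapping.keys f.
        Poly_Mapping.lookup f m * (\<Prod>i\<in>UNIV. v $ i ^ Poly_Mapping.lookup m i))"

definition forms2 :: "'a::field poly5 set" where
  "forms2 = {f. \<forall>m\<in>Poly_Mapping.keys f. (\<Sum>i\<in>UNIV. Poly_Mapping.lookup m i) = 2}"

definition zero_set :: "'a::field poly5 \<Rightarrow> ('a ^ 5) set set" where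
  "zero_set f = {x \<in> PG4. \<forall>v\<in>x. eval_poly5 f v = 0}"

section \<open>The hermitian variety\<close>

definition hermitian_variety :: "nat \<Rightarrow> ('a::field ^ 5) set set" where
  "hermitian_variety t = {x \<in> PG4. \<forall>v\<in>x. (\<Sum>i\<in>UNIV. v $ i ^ (t + 1)) = 0}"

definition tangent_at :: "nat \<Rightarrow> ('a::field ^ 5) set \<Rightarrow> ('a ^ 5) set set" where
  "tangent_at t P = {x \<in> PG4. \<forall>p\<in>P. \<forall>v\<in>x. (\<Sum>i\<in>UNIV. p $ i ^ t * v $ i) = 0}"

definition tangent_hyperplane :: "nat \<Rightarrow> ('a::field ^ 5) set set \<Rightarrow> bool" where
  "tangent_hyperplane t H \<longleftrightarrow> (\<exists>P\<in>hermitian_variety t. H = tangent_at t P)"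

definition hermitian_form :: "nat \<Rightarrow> 'a::field ^ 5 \<Rightarrow> 'a ^ 5 \<Rightarrow> 'a" where
  "hermitian_form t u v = (\<Sum>i\<in>UNIV. u $ i ^ t * v $ i)"

text \<open>
  The rank of the hermitian form restricted to a subspace \<open>W\<close> is the codimension in \<open>W\<close> of the
  radical of the restriction.
\<close>

definition hermitian_rank :: "nat \<Rightarrow> ('a::field ^ 5) set \<Rightarrow> nat" where
  "hermitian_rank t W =
     vec.dim W - vec.dim {v \<in> W. \<forall>u\<in>W. hermitian_form t u v = 0}"

text \<open>
  For a plane \<open>\<pi>\<close>, a set of points, \<open>vec.span (\<Union>\<pi>)\<close> is the underlying three-dimensional
  vector space.
\<close>

definition nonsingular_section :: "nat \<Rightarrow> ('a::field ^ 5) set set \<Rightarrow> bool" where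
  "nonsingular_section t \<pi> \<longleftrightarrow> hermitian_rank t (vec.span (\<Union>\<pi>)) = 3"

section \<open>The functional code\<close>

text \<open>
  The value \<open>f(x\<^sub>0,\<dots>,x\<^sub>4) / x\<^sub>i\<^sup>2\<close> is computed from an arbitrary coordinate vector of the point;
  it does not depend on the choice, see \<open>code_value_span\<close> below.
\<close>

definition code_value :: "'a::field poly5 \<Rightarrow> ('a ^ 5) set \<Rightarrow> 'a" where
  "code_value f x =
     (let v = (SOME v. v \<in> x \<and> v \<noteq> 0) in eval_poly5 f v / (v $ (LEAST i. v $ i \<noteq> 0))\<^sup>2)"

text \<open>
  A word is a family of field elements indexed by the points of the hermitian variety, that is,
  an extensional function on it.
\<close>

definition codeword :: "nat \<Rightarrow> 'a::field poly5 \<Rightarrow> ('a ^ 5) set \<Rightarrow> 'a" where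
  "codeword t f = restrict (code_value f) (hermitian_variety t)"

definition functional_code :: "nat \<Rightarrow> (('a::field ^ 5) set \<Rightarrow> 'a) set" where
  "functional_code t = codeword t ` forms2"

definition zero_word :: "nat \<Rightarrow> ('a::field ^ 5) set \<Rightarrow> 'a" where
  "zero_word t = restrict (\<lambda>_. 0) (hermitian_variety t)"

definition weight :: "nat \<Rightarrow> (('a::field ^ 5) set \<Rightarrow> 'a) \<Rightarrow> nat" where
  "weight t w = card {x \<in> hermitian_variety t. w x \<noteq> 0}"

definition weights :: "'a::field itself \<Rightarrow> nat \<Rightarrow> nat set" where
  "weights _ t = weight t ` ((functional_code t :: (('a ^ 5) set \<Rightarrow> 'a) set) - {zero_word t})"

text \<open>The \<open>n\<close>-th smallest element of a set of numbers, counting from \<open>n = 1\<close>.\<close>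

definition is_nth_smallest :: "nat set \<Rightarrow> nat \<Rightarrow> nat \<Rightarrow> bool" where
  "is_nth_smallest S n w \<longleftrightarrow> w \<in> S \<and> finite {u \<in> S. u < w} \<and> card {u \<in> S. u < w} + 1 = n"

section \<open>Consistency of the definitions\<close>

lemma eval_poly5_scale:
  assumes "f \<in> forms2"
  shows "eval_poly5 f (c *s v) = c\<^sup>2 * eval_poly5 f v"
proof -
  have "Poly_Mapping.lookup f m * (\<Prod>i\<in>UNIV. (c *s v) $ i ^ Poly_Mapping.lookup m i) =
      c\<^sup>2 * (Poly_Mapping.lookup f m * (\<Prod>i\<in>UNIV. v $ i ^ Poly_Mapping.lookup m i))"
    if "m \<in> Poly_Mapping.keys f" for m
  proof -
    have "(\<Sum>i\<in>UNIV. Poly_Mapping.lookup m i) = 2"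
      using assms that by (simp add: forms2_def)
    then have "(\<Prod>i\<in>UNIV. c ^ Poly_Mapping.lookup m i) = c\<^sup>2"
      by (metis power_sum)
    then show ?thesis
      by (simp add: power_mult_distrib prod.distrib mult.left_commute)
  qed
  then show ?thesis
    unfolding eval_poly5_def sum_distrib_left by (rule sum.cong[OF refl])
qed

lemma code_value_span:
  assumes "f \<in> forms2" "v \<noteq> 0"
  shows "code_value f (vec.span {v}) = eval_poly5 f v / (v $ (LEAST i. v $ i \<noteq> 0))\<^sup>2"
proof -
  define w where "w = (SOME w. w \<in> vec.span {v} \<and> w \<noteq> 0)"
  have "w \<in> vec.span {v} \<and> w \<noteq> 0"
    unfolding w_def by (rule someI[of _ v]) (use assms vec.span_base in auto)
  then obtain c where c: "w = c *s v" "c \<noteq> 0"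
    by (auto simp: vec.span_singleton)
  then have "(LEAST i. w $ i \<noteq> 0) = (LEAST i. v $ i \<noteq> 0)"
    by simp
  then show ?thesis
    unfolding code_value_def w_def[symmetric] Let_def
    using c eval_poly5_scale[OF assms(1)] by (simp add: power_mult_distrib)
qed

lemma code_value_eq_0_iff:
  assumes "f \<in> forms2" "x \<in> PG4"
  shows "code_value f x = 0 \<longleftrightarrow> x \<in> zero_set f"
proof -
  obtain v where v: "x = vec.span {v}" "v \<noteq> 0"
    using assms(2) by (auto simp: PG4_def)
  then have "\<exists>i. v $ i \<noteq> 0"
    by (auto simp: vec_eq_iff)
  then have "v $ (LEAST i. v $ i \<noteq> 0) \<noteq> 0"
    by (rule LeastI_ex)
  then have "code_value f x = 0 \<longleftrightarrow> eval_poly5 f v = 0"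
    using code_value_span[OF assms(1) v(2)] v(1) by simp
  moreover have "(\<forall>w\<in>x. eval_poly5 f w = 0) \<longleftrightarrow> eval_poly5 f v = 0"
    using v eval_poly5_scale[OF assms(1)] vec.span_base[of v "{v}"]
    by (auto simp: vec.span_singleton)
  ultimately show ?thesis
    using assms(2) by (simp add: zero_set_def)
qed

lemma weight_codeword:
  fixes f :: "'a::{field,finite} poly5"
  assumes "f \<in> forms2"
  shows "weight t (codeword t f) =
    card (hermitian_variety t :: ('a ^ 5) set set) - card (hermitian_variety t \<inter> zero_set f)"
proof -
  have "{x \<in> hermitian_variety t. codeword t f x \<noteq> 0} =
      hermitian_variety t - hermitian_variety t \<inter> zero_set f"
    using code_value_eq_0_iff[OF assms]
    by (auto simp: codeword_def hermitian_variety_def)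
  then show ?thesis
    unfolding weight_def by (simp add: card_Diff_subset)
qed

end

theory Submission
  imports Defs
begin

text \<open>
  All counting is done with vectors instead of points. Let \<open>h\<close> be the hermitian form, \<open>F\<close> a quadratic
  form over the field of order \<open>q = t\<^sup>2\<close> with zero set \<open>Z\<close>, and \<open>tr z = z\<^sup>t + z\<close> the trace to the
  subfield \<open>K\<close> of order \<open>t\<close>. For each scalar \<open>b\<close> the function \<open>x \<mapsto> h x x + tr (b * F x)\<close> is a
  quadratic form in 10 variables over \<open>K\<close>. Counting pairs \<open>(b, x)\<close> with value 0 expresses the number
  of isotropic vectors in \<open>Z\<close> through the numbers of zeros of these forms and the cardinality of \<open>Z\<close>.
  The radical of such a form has dimension at most 5 over \<open>K\<close>, so its totally singular
  subspaces have dimension at most 7, which bounds its number of zeros. Unless \<open>Z\<close> is everything or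
  a pair of hyperplanes, \<open>Z\<close> has at most \<open>q\<^sup>4 + q\<^sup>3\<close> elements, and the resulting bound already excludes
  the three smallest weights. The pairs of hyperplanes are then counted by orthogonal decomposition.
\<close>

section \<open>Fields of square order\<close>

text \<open>The obstacle is that going through all types of quadrics, together with their position
  relative to the hermitian variety, would need many cases and a separate treatment of even
  characteristic. Summing over \<open>b\<close> avoids this: only the vectors of Z let their
  isotropy influence the sum, so a bound for each \<open>twist b\<close> and a crude bound for Z
  suffice. There is little room, however. A section of weight t^7 - t^5 - t^2 has 2t^7 + 2t^4 - 2t^5
  - t^2 isotropic vectors, which is the threshold to stay below. With the totally singular dimension
  rounded down to 7 for \<open>b \<noteq> 0\<close>, and with the exact hermitian count for
  \<open>b = 0\<close>, the comparison comes down to t^5 ((t(t-1))^2 + (t-2)) > 0. Rounding 15/2 up,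
  or using the general bound at \<open>b = 0\<close>, would already fail for t = 2. Since quadratic
  forms are handled together with their polarization, no division by 2 occurs.\<close>

lemma add_power_CHAR:
  fixes x y :: "'a::comm_ring_1"
  assumes "prime p" "CHAR('a) = p"
  shows "(x + y) ^ p = x ^ p + y ^ p"
proof -
  have p: "p > 0" using assms(1) prime_gt_0_nat by blast
  have "(x + y) ^ p = (\<Sum>k\<le>p. of_nat (p choose k) * x ^ k * y ^ (p - k))"
    by (rule binomial_ring)
  also have "\<dots> = (\<Sum>k\<in>{0, p}. of_nat (p choose k) * x ^ k * y ^ (p - k))"
  proof (rule sum.mono_neutral_right)
    show "\<forall>k\<in>{..p} - {0, p}. of_nat (p choose k) * x ^ k * y ^ (p - k) = 0"
    proof
      fix k assume "k \<in> {..p} - {0, p}"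
      then have "p dvd (p choose k)"
        using dvd_choose_prime[of k p] assms(1) p by auto
      then have "of_nat (p choose k) = (0::'a)"
        using assms(2) by (simp add: of_nat_eq_0_iff_char_dvd)
      then show "of_nat (p choose k) * x ^ k * y ^ (p - k) = 0" by simp
    qed
  qed auto
  also have "\<dots> = x ^ p + y ^ p"
    using p by simp
  finally show ?thesis .
qed

text \<open>Translation by 1 permutes the ring, so adding 1 to every summand leaves the sum of all
  elements unchanged.\<close>

lemma CARD_eq_0_in_finite_ring: "of_nat CARD('a) = (0::'a::{comm_ring_1,finite})"
proof -
  have "(\<Sum>y\<in>UNIV. y + 1) = (\<Sum>y\<in>UNIV. y::'a)"
    by (rule sum.reindex_bij_witness[of _ "\<lambda>y. y - 1" "\<lambda>y. y + 1"]) auto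
  then show ?thesis by (simp add: sum.distrib)
qed

text \<open>Multiplication by a nonzero x permutes the nonzero elements, and their product can be
  cancelled.\<close>

lemma power_CARD_eq_self:
  fixes x :: "'a::{field,finite}"
  shows "x ^ CARD('a) = x"
proof (cases "x = 0")
  case False
  let ?P = "\<Prod>y\<in>UNIV - {0}. y::'a"
  have "?P = (\<Prod>y\<in>UNIV - {0}. x * y)"
    by (rule prod.reindex_bij_witness[of _ "\<lambda>y. x * y" "\<lambda>y. y / x"]) (use False in auto)
  also have "\<dots> = x ^ (CARD('a) - 1) * ?P"
    by (simp add: prod.distrib card_Diff_singleton)
  finally have "x ^ (CARD('a) - 1) = 1" by simp
  then show ?thesis
    by (metis One_nat_def Suc_pred mult.right_neutral power_Suc zero_less_card_finite)
qed simp

lemma card_poly_fibre_le: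
  fixes c :: "'a::idom"
  assumes "degree p > 0"
  shows "card {x. poly p x = c} \<le> degree p"
proof -
  have eq: "degree (p - [:c:]) = degree p"
    unfolding diff_conv_add_uminus using assms by (intro degree_add_eq_left) simp
  then have "p - [:c:] \<noteq> 0"
    using assms by (metis degree_0 less_irrefl)
  from card_poly_roots_bound[OF this] show ?thesis
    unfolding eq by simp
qed

text \<open>Pigeonhole in the extremal case: one fibre below the maximum \<open>m\<close> would make
  \<open>A\<close> too small. It turns the root bounds for trace and norm into exact fibre
  sizes.\<close>

lemma fibre_card_eq:
  assumes fin: "finite A" "finite B"
    and map: "f ` A \<subseteq> B" and le: "\<And>b. b \<in> B \<Longrightarrow> card {a \<in> A. f a = b} \<le> m"
    and ge: "m * card B \<le> card A" and b: "b \<in> B"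
  shows "card {a \<in> A. f a = b} = m"
proof (rule ccontr)
  assume "card {a \<in> A. f a = b} \<noteq> m"
  then have "card {a \<in> A. f a = b} < m" using le[OF b] by simp
  then have "(\<Sum>b\<in>B. card {a \<in> A. f a = b}) < (\<Sum>b\<in>B. m)"
    using b fin le by (intro sum_strict_mono_ex1) auto
  moreover have "card A = (\<Sum>b\<in>B. card {a \<in> A. f a = b})"
    using sum.group[OF fin map, of "\<lambda>_. 1::nat"] by simp
  ultimately show False using ge by (simp add: mult.commute)
qed

section \<open>Conjugation, trace and norm for the quadratic extension\<close>

locale square_field =
  fixes t :: nat and field_type :: "'a::{field,finite} itself"
  assumes t_primepow: "primepow t"
    and card_field: "CARD('a) = t\<^sup>2"
begin

lemma t_ge_2: "t \<ge> 2"
  using t_primepow primepow_gt_Suc_0 by fastforce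

lemma t_pos [simp]: "t > 0" and t_neq_0 [simp]: "t \<noteq> 0"
  using t_ge_2 by simp_all

lemma conj_conj [simp]: "(x ^ t) ^ t = (x::'a)"
  using power_CARD_eq_self[of x] by (simp add: card_field power2_eq_square power_mult)

text \<open>The characteristic divides the field order t^2, so it is the prime of which t is a
  power, and \<open>x ^ t\<close> is an iterate of the Frobenius map.\<close>

lemma conj_add: "(x + y :: 'a) ^ t = x ^ t + y ^ t"
proof -
  obtain p k where pk: "prime p" "k > 0" "t = p ^ k"
    using t_primepow by (auto simp: primepow_def)
  have "CHAR('a) > 0" by (rule finite_imp_CHAR_pos) simp
  then have pr: "prime CHAR('a)" by (rule prime_CHAR_semidom)
  have "CHAR('a) dvd CARD('a)"
    using CARD_eq_0_in_finite_ring by (simp only: of_nat_eq_0_iff_char_dvd)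
  then have "CHAR('a) dvd p"
    unfolding card_field pk(3) using pr prime_dvd_power by blast
  then have char: "CHAR('a) = p"
    using pk(1) pr primes_dvd_imp_eq by blast
  have "(x + y :: 'a) ^ (p ^ n) = x ^ (p ^ n) + y ^ (p ^ n)" for n
    by (induction n) (simp_all add: power_mult mult.commute[of p] add_power_CHAR[OF pk(1) char])
  then show ?thesis by (simp add: pk(3))
qed

lemma conj_0 [simp]: "(0::'a) ^ t = 0"
  using t_ge_2 by simp

lemma conj_minus: "(- x :: 'a) ^ t = - (x ^ t)"
  using conj_add[of x "- x"] by (simp add: eq_neg_iff_add_eq_0 add.commute)

lemma conj_diff: "(x - y :: 'a) ^ t = x ^ t - y ^ t"
  using conj_add[of x "- y"] by (simp add: conj_minus)

lemma conj_sum: "(\<Sum>i\<in>I. f i :: 'a) ^ t = (\<Sum>i\<in>I. f i ^ t)"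
  by (induction I rule: infinite_finite_induct) (simp_all add: conj_add)

lemma conj_eq_0 [simp]: "x ^ t = 0 \<longleftrightarrow> x = (0::'a)"
  using t_ge_2 by simp

definition K :: "'a set" where
  "K = {x. x ^ t = x}"

definition tr :: "'a \<Rightarrow> 'a" where
  "tr x = x ^ t + x"

lemma tr_0 [simp]: "tr 0 = 0" and tr_add: "tr (x + y) = tr x + tr y"
  and tr_diff: "tr (x - y) = tr x - tr y"
  by (simp_all add: tr_def conj_add conj_minus conj_diff)

lemma tr_in_K [simp]: "tr x \<in> K"
  by (simp add: tr_def K_def conj_add add.commute)

lemma tr_scale: "c \<in> K \<Longrightarrow> tr (c * x) = c * tr x"
  by (simp add: tr_def K_def power_mult_distrib algebra_simps)

lemma card_tr_fibre_le: "card {x. tr x = c} \<le> t"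
proof -
  let ?p = "monom 1 t + [:0, 1:] :: 'a poly"
  have deg: "degree ?p = t"
    using t_ge_2 by (subst degree_add_eq_left) (auto simp: degree_monom_eq)
  have "{x. tr x = c} = {x. poly ?p x = c}"
    by (simp add: tr_def poly_monom)
  then show ?thesis
    using card_poly_fibre_le[of ?p c] t_ge_2 unfolding deg by simp
qed

text \<open>At most t because the elements are roots of X^t - X; at least t because the trace maps
  t^2 elements into \<open>K\<close> with fibres of at most t elements.\<close>

lemma card_K: "card K = t"
proof (rule antisym)
  let ?p = "monom 1 t + [:0, - 1:] :: 'a poly"
  have deg: "degree ?p = t"
    using t_ge_2 by (subst degree_add_eq_left) (auto simp: degree_monom_eq)
  have "K = {x. poly ?p x = 0}"
    by (simp add: K_def poly_monom)
  then show "card K \<le> t"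
    using card_poly_fibre_le[of ?p 0] t_ge_2 unfolding deg by simp
  have "t * t = card (UNIV :: 'a set)"
    by (simp add: card_field power2_eq_square)
  also have "\<dots> = (\<Sum>c\<in>K. card {x. tr x = c})"
    using sum.group[of UNIV K tr "\<lambda>_. 1::nat"] by (simp add: image_subset_iff)
  also have "\<dots> \<le> (\<Sum>c\<in>K. t)"
    by (rule sum_mono) (rule card_tr_fibre_le)
  finally show "t \<le> card K"
    using t_ge_2 by simp
qed

lemma card_tr_fibre:
  assumes "c \<in> K"
  shows "card {x. tr x = c} = t"
  using fibre_card_eq[of UNIV K tr t c] assms card_tr_fibre_le
  by (simp add: image_subset_iff card_K card_field power2_eq_square)

lemma card_tr_scale_fibre:
  assumes "a \<noteq> 0" "c \<in> K"
  shows "card {x. tr (x * a) = c} = t"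
proof -
  have "bij_betw (\<lambda>x. x * a) {x. tr (x * a) = c} {x. tr x = c}"
    by (rule bij_betwI[of _ _ _ "\<lambda>x. x / a"]) (use assms in auto)
  then show ?thesis
    using card_tr_fibre[OF assms(2)] by (simp add: bij_betw_same_card)
qed

text \<open>Nondegeneracy of the trace form: for nonzero \<open>a\<close> only t of the t^2 scalars
  \<open>c\<close> give trace 0. This is how equations over \<open>K\<close> are lifted to equations
  over the whole field.\<close>

lemma tr_scale_eq_0: "(\<And>c. tr (c * a) = 0) \<Longrightarrow> a = 0"
  using card_tr_scale_fibre[of a 0] t_ge_2 by (auto simp: K_def card_field power2_eq_square)

lemma norm_in_K [simp]: "x ^ t * x \<in> K"
  by (simp add: K_def power_mult_distrib mult.commute)

text \<open>The polynomial X^(t+1) - c has at most t + 1 roots, while t^2 - 1 = (t+1)(t-1) nonzero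
  elements have their norms among t - 1 values. The element 0 is set aside because its norm fibre is
  a single element.\<close>

lemma card_norm_fibre:
  assumes "c \<in> K" "c \<noteq> 0"
  shows "card {x. x ^ t * x = c} = t + 1"
proof -
  have "card {a \<in> UNIV - {0}. a ^ t * a = b} \<le> t + 1" for b :: 'a
  proof -
    have "{x. x ^ t * x = b} = {x. poly (monom 1 (t + 1)) x = b}"
      by (simp add: poly_monom mult.commute)
    then have "card {x. x ^ t * x = b} \<le> t + 1"
      using card_poly_fibre_le[of "monom 1 (t + 1) :: 'a poly" b] by (simp add: degree_monom_eq)
    moreover have "card {a \<in> UNIV - {0}. a ^ t * a = b} \<le> card {x. x ^ t * x = b}"
      by (rule card_mono) auto
    ultimately show ?thesis by linarith
  qed
  moreover have "(t + 1) * card (K - {0}) = card (UNIV - {0::'a})"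
  proof -
    have "0 \<in> K" by (simp add: K_def)
    then show ?thesis using t_ge_2
      by (simp add: card_K card_field power2_eq_square algebra_simps)
  qed
  ultimately have "card {x \<in> UNIV - {0}. x ^ t * x = c} = t + 1"
    using assms by (intro fibre_card_eq[where B = "K - {0}"]) (auto simp: image_subset_iff)
  moreover have "{x \<in> UNIV - {0}. x ^ t * x = c} = {x. x ^ t * x = c}"
    using assms by auto
  ultimately show ?thesis by simp
qed

lemma K_0 [simp]: "0 \<in> K" and K_1 [simp]: "1 \<in> K"
  and K_add: "x \<in> K \<Longrightarrow> y \<in> K \<Longrightarrow> x + y \<in> K"
  and K_minus: "x \<in> K \<Longrightarrow> - x \<in> K"
  and K_mult: "x \<in> K \<Longrightarrow> y \<in> K \<Longrightarrow> x * y \<in> K"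
  and K_inverse: "x \<in> K \<Longrightarrow> inverse x \<in> K"
  by (simp_all add: K_def conj_add conj_minus power_mult_distrib power_inverse)

end

section \<open>Zeros of quadratic forms over a subfield\<close>

text \<open>Not divided by 2, and used beside the form itself: in characteristic 2 the form cannot
  be recovered from its polarization.\<close>

definition polar :: "('a::ab_group_add ^ 'n \<Rightarrow> 'a) \<Rightarrow> 'a ^ 'n \<Rightarrow> 'a ^ 'n \<Rightarrow> 'a" where
  "polar g x y = g (x + y) - g x - g y"

lemma polar_commute: "polar g x y = polar g y x"
  by (simp add: polar_def add.commute)

lemma polar_expand: "g (x + y) = g x + g y + polar g x y"
  by (simp add: polar_def)

text \<open>\<open>S\<close> is a subfield acting on vectors over the full field. The same theory
  then serves the quadric over \<open>UNIV\<close> and the forms \<open>twist b\<close> over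
  \<open>K\<close>, on one and the same set of vectors.\<close>

locale quadratic_form =
  fixes S :: "'a::{field,finite} set" and g :: "'a ^ 'n \<Rightarrow> 'a"
  assumes S_0 [simp]: "0 \<in> S" and S_1 [simp]: "1 \<in> S"
    and S_add: "a \<in> S \<Longrightarrow> b \<in> S \<Longrightarrow> a + b \<in> S"
    and S_minus: "a \<in> S \<Longrightarrow> - a \<in> S"
    and S_mult: "a \<in> S \<Longrightarrow> b \<in> S \<Longrightarrow> a * b \<in> S"
    and S_inverse: "a \<in> S \<Longrightarrow> inverse a \<in> S"
    and g_in_S: "g x \<in> S"
    and g_scale: "a \<in> S \<Longrightarrow> g (a *s x) = a\<^sup>2 * g x"
    and polar_add: "polar g (x + y) z = polar g x z + polar g y z"
    and polar_scale: "a \<in> S \<Longrightarrow> polar g (a *s x) y = a * polar g x y"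
begin

lemma polar_add_right: "polar g z (x + y) = polar g z x + polar g z y"
  and polar_scale_right: "a \<in> S \<Longrightarrow> polar g y (a *s x) = a * polar g y x"
  by (simp only: polar_commute[of g z] polar_add) (simp only: polar_commute[of g y] polar_scale)

lemma S_diff: "a \<in> S \<Longrightarrow> b \<in> S \<Longrightarrow> a - b \<in> S"
  using S_add[of a "- b"] S_minus[of b] by simp

lemma S_divide: "a \<in> S \<Longrightarrow> b \<in> S \<Longrightarrow> a / b \<in> S"
  by (simp add: divide_inverse S_mult S_inverse)

lemma polar_in_S: "polar g x y \<in> S"
  by (simp add: polar_def S_diff g_in_S)

lemma g_0 [simp]: "g 0 = 0"
  using g_scale[of 0 0] by simp

lemma polar_0 [simp]: "polar g 0 x = 0" "polar g x 0 = 0"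
  by (simp_all add: polar_def)

lemma polar_self: "g v = 0 \<Longrightarrow> polar g v v = 0"
proof -
  assume v: "g v = 0"
  have "v + v = (1 + 1) *s v" by (simp only: vec.scale_left_distrib vec.scale_one)
  then have "g (v + v) = 0"
    using v by (simp only: g_scale[OF S_add[OF S_1 S_1]]) simp
  then show ?thesis using v by (simp add: polar_def)
qed

lemma card_S_ge_2: "card S \<ge> 2"
  using card_mono[of S "{0, 1}"] by simp

definition subsp :: "('a ^ 'n) set \<Rightarrow> bool" where
  "subsp V \<longleftrightarrow> 0 \<in> V \<and> (\<forall>x\<in>V. \<forall>y\<in>V. x + y \<in> V) \<and> (\<forall>a\<in>S. \<forall>x\<in>V. a *s x \<in> V)"

lemma subspD: "subsp V \<Longrightarrow> 0 \<in> V" "subsp V \<Longrightarrow> x \<in> V \<Longrightarrow> y \<in> V \<Longrightarrow> x + y \<in> V"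
  "subsp V \<Longrightarrow> a \<in> S \<Longrightarrow> x \<in> V \<Longrightarrow> a *s x \<in> V"
  by (simp_all add: subsp_def)

lemma subsp_diff:
  assumes "subsp V" "x \<in> V" "y \<in> V"
  shows "x - y \<in> V"
proof -
  have "(- 1) *s y \<in> V" using assms S_minus[OF S_1] by (intro subspD)
  then have "x + (- 1) *s y \<in> V" using assms by (intro subspD(2))
  then show ?thesis by (simp add: vec.scale_minus_left)
qed

text \<open>The translates of \<open>U\<close> by the \<open>S\<close>-multiples of a vector outside
  \<open>U\<close> are disjoint. Cardinalities take the place of dimensions over
  \<open>S\<close>.\<close>

lemma card_proper_subsp:
  assumes U: "subsp U" and V: "subsp V" and "U \<subset> V"
  shows "card S * card U \<le> card V"
proof -
  obtain v where v: "v \<in> V" "v \<notin> U" using assms by blast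
  have "inj_on (\<lambda>(c, u). c *s v + u) (S \<times> U)"
  proof (rule inj_onI, clarify)
    fix c u d w assume *: "c \<in> S" "u \<in> U" "d \<in> S" "w \<in> U" "c *s v + u = d *s v + w"
    then have eq: "(c - d) *s v = w - u"
      by (simp add: vec.scale_left_diff_distrib algebra_simps)
    have "c = d"
    proof (rule ccontr)
      assume "c \<noteq> d"
      then have "v = inverse (c - d) *s (w - u)"
        using \<open>c \<noteq> d\<close> by (simp only: eq[symmetric] vec.scale_scale) simp
      also have "\<dots> \<in> U"
        using * U by (intro subspD(3)[OF U] S_inverse S_diff subsp_diff) auto
      finally show False using v by simp
    qed
    then show "c = d \<and> u = w" using *(5) by simp
  qed
  moreover have "(\<lambda>(c, u). c *s v + u) ` (S \<times> U) \<subseteq> V"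
    using assms v by (auto intro!: subspD(2,3)[OF V])
  ultimately have "card (S \<times> U) \<le> card V"
    by (intro card_inj_on_le) auto
  then show ?thesis by (simp add: card_cartesian_product)
qed

section \<open>Radicals and hyperbolic planes\<close>

definition radical :: "('a ^ 'n) set \<Rightarrow> ('a ^ 'n) set" where
  "radical V = {x \<in> V. \<forall>y\<in>V. polar g x y = 0}"

definition zeros :: "('a ^ 'n) set \<Rightarrow> ('a ^ 'n) set" where
  "zeros V = {x \<in> V. g x = 0}"

definition pair_perp :: "'a ^ 'n \<Rightarrow> 'a ^ 'n \<Rightarrow> ('a ^ 'n) set \<Rightarrow> ('a ^ 'n) set" where
  "pair_perp v w V = {y \<in> V. polar g v y = 0 \<and> polar g w y = 0}"

lemma subsp_radical: "subsp V \<Longrightarrow> subsp (radical V)"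
  by (auto simp: subsp_def radical_def polar_add polar_scale)

lemma subsp_pair_perp: "subsp V \<Longrightarrow> subsp (pair_perp v w V)"
  by (auto simp: subsp_def pair_perp_def polar_add_right polar_scale_right)

lemma subsp_UNIV: "subsp UNIV"
  by (simp add: subsp_def)

text \<open>For \<open>c = 0\<close> the solutions are the two axes, 2|S| - 1 pairs; otherwise each
  nonzero x determines y.\<close>

lemma card_hyperbola:
  assumes b: "b \<in> S" "b \<noteq> 0" and c: "c \<in> S"
  shows "card {(x, y) \<in> S \<times> S. x * y * b + c = 0} = (card S - 1) + (if c = 0 then card S else 0)"
proof (cases "c = 0")
  case True
  have "{(x, y) \<in> S \<times> S. x * y * b + c = 0} = ({0} \<times> S) \<union> ((S - {0}) \<times> {0})"
    using b True by auto
  also have "card \<dots> = card ({0::'a} \<times> S) + card ((S - {0}) \<times> {0::'a})"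
    by (rule card_Un_disjoint) auto
  finally show ?thesis
    using True by (simp add: card_cartesian_product)
next
  case False
  have "bij_betw (\<lambda>x. (x, - c / (x * b))) (S - {0}) {(x, y) \<in> S \<times> S. x * y * b + c = 0}"
  proof (rule bij_betwI[of _ _ _ fst])
    show "(\<lambda>x. (x, - c / (x * b))) \<in> S - {0} \<rightarrow> {(x, y) \<in> S \<times> S. x * y * b + c = 0}"
      using b c by (auto intro!: S_divide S_mult S_minus)
    show "fst \<in> {(x, y) \<in> S \<times> S. x * y * b + c = 0} \<rightarrow> S - {0}"
      using False by auto
    show "(fst p, - c / (fst p * b)) = p" if "p \<in> {(x, y) \<in> S \<times> S. x * y * b + c = 0}" for p
    proof -
      obtain x y where p: "p = (x, y)" by (cases p)
      then have "x * y * b + c = 0" using that by simp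
      then have "c = - (x * y * b)" "x \<noteq> 0" using False
        by (auto simp: add_eq_0_iff)
      then show ?thesis using p b by simp
    qed
  qed auto
  then have "card {(x, y) \<in> S \<times> S. x * y * b + c = 0} = card (S - {0})"
    by (simp add: bij_betw_same_card)
  then show ?thesis using False by simp
qed

context
  fixes V v w
  assumes V: "subsp V" and v: "v \<in> V" "g v = 0" and w: "w \<in> V" "g w = 0"
    and vw: "polar g v w \<noteq> 0"
begin

text \<open>Since \<open>v\<close> and \<open>w\<close> are singular, each is orthogonal to itself;
  pairing with \<open>w\<close> therefore reads off the coefficient of \<open>v\<close>, and pairing
  with \<open>v\<close> that of \<open>w\<close>.\<close>

lemma bij_hyperbolic_split:
  "bij_betw (\<lambda>((a, b), y). a *s v + b *s w + y) ((S \<times> S) \<times> pair_perp v w V) V"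
proof -
  define h where "h p = (case p of ((a, b), y) \<Rightarrow> a *s v + b *s w + y)" for p :: "('a \<times> 'a) \<times> ('a ^ 'n)"
  define \<alpha> where "\<alpha> x = polar g w x / polar g v w" for x
  define \<beta> where "\<beta> x = polar g v x / polar g v w" for x
  define d where "d x = ((\<alpha> x, \<beta> x), x - (\<alpha> x *s v + \<beta> x *s w))" for x
  have vv: "polar g v v = 0" "polar g w w = 0" "polar g w v = polar g v w"
    using v w polar_self by (simp_all add: polar_commute)
  have diff: "polar g u (x - y) = polar g u x - polar g u y" for u x y
    using polar_add_right[of u "x - y" y] by simp
  have "bij_betw h ((S \<times> S) \<times> pair_perp v w V) V"
  proof (rule bij_betwI[of _ _ _ d])
    show "h \<in> (S \<times> S) \<times> pair_perp v w V \<rightarrow> V"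
      using v w by (auto simp: h_def pair_perp_def intro!: subspD[OF V])
    show "d \<in> V \<rightarrow> (S \<times> S) \<times> pair_perp v w V"
    proof
      fix x assume x: "x \<in> V"
      have ab: "\<alpha> x \<in> S" "\<beta> x \<in> S" by (simp_all add: \<alpha>_def \<beta>_def S_divide polar_in_S)
      have "x - (\<alpha> x *s v + \<beta> x *s w) \<in> V"
        using ab v w x by (intro subsp_diff V subspD[OF V])
      moreover have "polar g v (x - (\<alpha> x *s v + \<beta> x *s w)) = 0"
          "polar g w (x - (\<alpha> x *s v + \<beta> x *s w)) = 0"
        using ab vv vw by (simp_all add: diff polar_add_right polar_scale_right)
          (simp_all add: \<alpha>_def \<beta>_def)
      ultimately show "d x \<in> (S \<times> S) \<times> pair_perp v w V"
        using ab by (simp add: d_def pair_perp_def)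
    qed
    show "d (h p) = p" if p: "p \<in> (S \<times> S) \<times> pair_perp v w V" for p
    proof -
      obtain a b y where p: "p = ((a, b), y)"
        by (metis surj_pair)
      then have "a \<in> S" "b \<in> S" "polar g v y = 0" "polar g w y = 0"
        using that by (simp_all add: pair_perp_def)
      then have "\<alpha> (h p) = a" "\<beta> (h p) = b"
        using p vv vw by (simp_all add: \<alpha>_def \<beta>_def h_def polar_add_right polar_scale_right)
      then show ?thesis by (simp add: d_def) (simp add: h_def p)
    qed
  qed (simp add: h_def d_def)
  then show ?thesis by (simp add: h_def[abs_def] case_prod_unfold)
qed

lemma hyperbolic_splitE:
  assumes "x \<in> V"
  obtains a b y where "x = a *s v + b *s w + y" "a \<in> S" "b \<in> S" "y \<in> pair_perp v w V"
  using bij_hyperbolic_split assms unfolding bij_betw_def image_def by fastforce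

lemma hyperbolic_split_in:
  "a \<in> S \<Longrightarrow> b \<in> S \<Longrightarrow> y \<in> pair_perp v w V \<Longrightarrow> a *s v + b *s w + y \<in> V"
  using v w by (auto simp: pair_perp_def intro!: subspD[OF V])

lemma g_hyperbolic_split:
  assumes "a \<in> S" "b \<in> S" "y \<in> pair_perp v w V"
  shows "g (a *s v + b *s w + y) = a * b * polar g v w + g y"
  using assms v w
  by (simp add: polar_expand[of g "a *s v + b *s w"] polar_expand[of g "a *s v"] g_scale
      polar_add polar_scale polar_scale_right pair_perp_def)

lemma card_hyperbolic_split: "card V = (card S)\<^sup>2 * card (pair_perp v w V)"
  using bij_betw_same_card[OF bij_hyperbolic_split]
  by (simp add: card_cartesian_product power2_eq_square)

text \<open>On the splitting, \<open>g\<close> becomes \<open>a * b * polar g v w + g y\<close>.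
  Each \<open>y\<close> thus contributes |S| - 1 pairs, and |S| further ones if it is itself a
  zero.\<close>

lemma card_zeros_hyperbolic_split:
  "card (zeros V) =
     card S * card (zeros (pair_perp v w V)) + (card S - 1) * card (pair_perp v w V)"
proof -
  let ?P = "pair_perp v w V" and ?h = "\<lambda>((a, b), y). a *s v + b *s w + y"
  let ?D = "{((a, b), y). a \<in> S \<and> b \<in> S \<and> y \<in> ?P \<and> a * b * polar g v w + g y = 0}"
  have D: "?D \<subseteq> (S \<times> S) \<times> ?P" by auto
  have "?h ` ?D = zeros V"
  proof
    show "?h ` ?D \<subseteq> zeros V"
      by (auto simp: zeros_def g_hyperbolic_split hyperbolic_split_in)
    show "zeros V \<subseteq> ?h ` ?D"
    proof
      fix x assume x: "x \<in> zeros V"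
      then obtain a b y where "x = a *s v + b *s w + y" "a \<in> S" "b \<in> S" "y \<in> ?P"
        using hyperbolic_splitE unfolding zeros_def by blast
      then show "x \<in> ?h ` ?D"
        using x by (force simp: zeros_def g_hyperbolic_split)
    qed
  qed
  moreover have "inj_on ?h ?D"
    using bij_hyperbolic_split D by (auto simp: bij_betw_def intro: inj_on_subset)
  ultimately have "bij_betw ?h ?D (zeros V)"
    by (simp only: bij_betw_def)
  then have "card (zeros V) = card ?D"
    by (rule bij_betw_same_card[symmetric])
  also have "card ?D = card (SIGMA y:?P. {(a, b) \<in> S \<times> S. a * b * polar g v w + g y = 0})"
    by (rule bij_betw_same_card[of prod.swap], rule bij_betwI[of _ _ _ prod.swap]) auto
  also have "\<dots> = (\<Sum>y\<in>?P. card {(a, b) \<in> S \<times> S. a * b * polar g v w + g y = 0})"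
    by (rule card_SigmaI) auto
  also have "\<dots> = (\<Sum>y\<in>?P. (card S - 1) + (if g y = 0 then card S else 0))"
    using vw by (intro sum.cong card_hyperbola polar_in_S g_in_S) auto
  also have "\<dots> = (card S - 1) * card ?P + card S * card (zeros ?P)"
    by (simp add: sum.distrib sum.If_cases zeros_def Int_def)
  finally show ?thesis by simp
qed

text \<open>The radical does not grow when a hyperbolic plane is removed, so its bound survives the
  induction in \<open>card_zeros_le\<close>.\<close>

lemma radical_hyperbolic_split: "radical (pair_perp v w V) \<subseteq> radical V"
proof
  fix x assume x: "x \<in> radical (pair_perp v w V)"
  show "x \<in> radical V"
    unfolding radical_def
  proof (clarify, intro conjI ballI)
    show "x \<in> V" using x by (simp add: radical_def pair_perp_def)
    fix y assume "y \<in> V"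
    then obtain a b z where "y = a *s v + b *s w + z" "a \<in> S" "b \<in> S" "z \<in> pair_perp v w V"
      using hyperbolic_splitE by blast
    moreover have "polar g x v = 0" "polar g x w = 0"
      using x by (simp_all add: radical_def pair_perp_def polar_commute)
    ultimately show "polar g x y = 0"
      using x by (simp add: polar_add_right polar_scale_right radical_def)
  qed
qed

end

text \<open>Because \<open>g v = 0\<close>, the value \<open>g (u + c *s v)\<close> is linear in
  \<open>c\<close> with slope \<open>polar g v u\<close>, hence vanishes for one
  \<open>c\<close>.\<close>

lemma singular_partner:
  assumes V: "subsp V" and v: "v \<in> V" "g v = 0" and u: "u \<in> V" "polar g v u \<noteq> 0"
  obtains w where "w \<in> V" "g w = 0" "polar g v w \<noteq> 0"
proof
  define c where "c = - g u / polar g v u"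
  have c: "c \<in> S" by (simp add: c_def S_divide S_minus g_in_S polar_in_S)
  show "u + c *s v \<in> V" using V c u v by (intro subspD)
  show "g (u + c *s v) = 0"
    using c u v by (simp add: polar_expand[of g u] g_scale polar_scale polar_commute[of g u])
      (simp add: c_def)
  show "polar g v (u + c *s v) \<noteq> 0"
    using c u v by (simp add: polar_add_right polar_scale_right polar_self)
qed

text \<open>
  The exponent \<open>(n + r) div 2\<close> is the largest possible dimension of a totally singular subspace;
  rounding it down makes the bound sharp enough when \<open>n + r\<close> is odd.
\<close>

lemma card_zeros_le:
  assumes "subsp V" "card V = card S ^ n" "card (radical V) \<le> card S ^ r"
  shows "card S * card (zeros V) \<le> card S ^ n + (card S - 1) * card S ^ ((n + r) div 2)"
  using assms
proof (induction n arbitrary: V rule: less_induct)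
  case (less n)
  note k = card_S_ge_2
  show ?case
  \<comment> \<open>If all zeros lie in the radical, its size settles the count. Otherwise a
    singular vector outside the radical spans a hyperbolic plane with a partner, and induction
    applies to the complement, two dimensions smaller.\<close>
  proof (cases "zeros V \<subseteq> radical V")
    case True
    then have le: "card (zeros V) \<le> card (radical V)"
      by (intro card_mono) auto
    show ?thesis
    proof (cases "radical V = V")
      case True
      then have "card S ^ n \<le> card S ^ r" using less.prems by simp
      then have "n \<le> r" using k by (simp add: power_le_imp_le_exp)
      then have "card S ^ n \<le> card S ^ ((n + r) div 2)"
        using k by (intro power_increasing) auto
      then have "(card S - 1) * card S ^ n \<le> (card S - 1) * card S ^ ((n + r) div 2)"
        by (rule mult_le_mono2)
      moreover have "card S * card (zeros V) \<le> card S * card S ^ n"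
        using le True less.prems by simp
      moreover have "card S * card S ^ n = card S ^ n + (card S - 1) * card S ^ n"
        using k by (cases "card S") auto
      ultimately show ?thesis by linarith
    next
      case False
      then have "radical V \<subset> V" by (auto simp: radical_def)
      then have "card S * card (radical V) \<le> card V"
        using less.prems(1) by (intro card_proper_subsp subsp_radical)
      then show ?thesis using le less.prems(2)
        by (metis mult_le_mono2 order_trans trans_le_add1)
    qed
  next
    case False
    then obtain v u where v: "v \<in> V" "g v = 0" and u: "u \<in> V" "polar g v u \<noteq> 0"
      by (auto simp: zeros_def radical_def)
    then obtain w where w: "w \<in> V" "g w = 0" "polar g v w \<noteq> 0"
      using singular_partner less.prems(1) by blast
    let ?P = "pair_perp v w V"
    note split = less.prems(1) v w
    have "0 \<in> ?P" using subspD(1)[OF subsp_pair_perp[OF less.prems(1)]] .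
    then have "card ?P \<ge> 1" by (metis One_nat_def Suc_leI card_gt_0_iff empty_iff finite)
    then have "card S ^ 2 \<le> card S ^ n"
      using card_hyperbolic_split[OF split] less.prems(2) by simp
    then have "n \<ge> 2" using k by (simp add: power_le_imp_le_exp)
    then obtain m where m: "n = m + 2" by (metis add.commute le_Suc_ex)
    have cP: "card ?P = card S ^ m"
      using card_hyperbolic_split[OF split] less.prems(2) k unfolding m
      by (auto simp: power2_eq_square)
    have "card (radical ?P) \<le> card S ^ r"
      using card_mono[OF _ radical_hyperbolic_split[OF split]] less.prems(3) by (meson finite le_trans)
    then have IH: "card S * card (zeros ?P) \<le> card S ^ m + (card S - 1) * card S ^ ((m + r) div 2)"
      using less.IH[of m ?P] m less.prems(1) cP by (simp add: subsp_pair_perp)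
    have "card (zeros V) = card S * card (zeros ?P) + (card S - 1) * card S ^ m"
      using card_zeros_hyperbolic_split[OF split] cP by simp
    also have "\<dots> \<le> card S ^ m + (card S - 1) * card S ^ ((m + r) div 2) + (card S - 1) * card S ^ m"
      using IH by simp
    also have "\<dots> = card S * card S ^ m + (card S - 1) * card S ^ ((m + r) div 2)"
      using k by (cases "card S") auto
    finally have "card S * card (zeros V) \<le>
        card S * (card S * card S ^ m + (card S - 1) * card S ^ ((m + r) div 2))"
      by (rule mult_le_mono2)
    also have "\<dots> = card S ^ n + (card S - 1) * card S ^ ((n + r) div 2)"
      by (simp add: m algebra_simps)
    finally show ?thesis .
  qed
qed

text \<open>On a line in the direction of a nonsingular vector, \<open>g\<close> is a polynomial of degree 2.\<close>

lemma card_zeros_le_of_nonzero: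
  assumes V: "subsp V" and v: "v \<in> V" "g v \<noteq> 0"
  shows "card S * card (zeros V) \<le> 2 * card V"
proof -
  have line: "card {a \<in> S. g (x + a *s v) = 0} \<le> 2" for x
  proof -
    let ?p = "[:g x, polar g x v, g v:]"
    have "{a \<in> S. g (x + a *s v) = 0} \<subseteq> {a. poly ?p a = 0}"
      by (auto simp: polar_expand[of g x] g_scale polar_scale_right power2_eq_square algebra_simps)
    then have "card {a \<in> S. g (x + a *s v) = 0} \<le> card {a. poly ?p a = 0}"
      by (intro card_mono) auto
    also have "\<dots> \<le> 2"
      using card_poly_fibre_le[of ?p 0] v by simp
    finally show ?thesis .
  qed
  \<comment> \<open>Translation by any multiple of \<open>v\<close> permutes \<open>V\<close>, so
    the zeros are counted |S| times; exchanging the sums counts them line by line.\<close>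
  have "card S * card (zeros V) = (\<Sum>a\<in>S. card {x \<in> V. g (x + a *s v) = 0})"
  proof -
    have "card {x \<in> V. g (x + a *s v) = 0} = card (zeros V)" if "a \<in> S" for a
    proof (rule bij_betw_same_card)
      show "bij_betw (\<lambda>x. x + a *s v) {x \<in> V. g (x + a *s v) = 0} (zeros V)"
        using V v that
        by (intro bij_betwI[of _ _ _ "\<lambda>x. x - a *s v"])
          (auto simp: zeros_def intro!: subspD subsp_diff)
    qed
    then show ?thesis by simp
  qed
  also have "\<dots> = (\<Sum>x\<in>V. card {a \<in> S. g (x + a *s v) = 0})"
    by (rule sum_multicount_gen) auto
  also have "\<dots> \<le> (\<Sum>x\<in>V. 2)"
    by (rule sum_mono) (rule line)
  finally show ?thesis by (simp add: mult.commute)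
qed

end

section \<open>Isotropic vectors of the hermitian form\<close>

lemma hermitian_form_add_right: "hermitian_form t x (y + z) = hermitian_form t x y + hermitian_form t x z"
  and hermitian_form_scale_right: "hermitian_form t x (c *s y) = c * hermitian_form t x y"
  and hermitian_form_diff_right: "hermitian_form t x (y - z) = hermitian_form t x y - hermitian_form t x z"
  by (simp_all add: hermitian_form_def algebra_simps sum.distrib sum_distrib_left sum_subtractf)

lemma hermitian_form_0_right [simp]: "hermitian_form t x 0 = 0"
  by (simp add: hermitian_form_def)

text \<open>The polar hyperplane of \<open>p\<close>. For nonzero \<open>p\<close> it is tangent
  exactly when \<open>p\<close> is isotropic.\<close>

definition perp :: "nat \<Rightarrow> 'a::field ^ 5 \<Rightarrow> ('a ^ 5) set" where
  "perp t p = {x. hermitian_form t p x = 0}"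

lemma subspace_perp: "vec.subspace (perp t p)"
  by (auto simp: vec.subspace_def perp_def hermitian_form_add_right hermitian_form_scale_right)

text \<open>The zero vector is included, which accounts for the difference of 1 when vectors are
  converted to points.\<close>

definition isotropic :: "nat \<Rightarrow> ('a::field ^ 5) set \<Rightarrow> ('a ^ 5) set" where
  "isotropic t W = {x \<in> W. hermitian_form t x x = 0}"

context square_field
begin

abbreviation h :: "'a ^ 5 \<Rightarrow> 'a ^ 5 \<Rightarrow> 'a" where
  "h \<equiv> hermitian_form t"

lemma h_commute: "h y x = h x y ^ t"
  by (simp add: hermitian_form_def conj_sum power_mult_distrib mult.commute)

lemma h_add_left: "h (x + y) z = h x z + h y z"
  by (simp add: hermitian_form_def conj_add algebra_simps sum.distrib)

lemma h_diff_left: "h (x - y) z = h x z - h y z"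
  by (simp add: hermitian_form_def conj_diff algebra_simps sum_subtractf)

lemma h_scale_left: "h (c *s x) y = c ^ t * h x y"
  by (simp add: hermitian_form_def power_mult_distrib algebra_simps sum_distrib_left)

lemmas h_linear = hermitian_form_add_right hermitian_form_scale_right hermitian_form_diff_right
  h_add_left h_diff_left h_scale_left

lemma h_0_left [simp]: "h 0 x = 0"
  using h_commute[of 0 x] by simp

lemma h_eq_0_commute: "h y x = 0 \<longleftrightarrow> h x y = 0"
  by (subst h_commute) simp

lemma h_axis: "h (axis i 1) x = x $ i"
proof -
  have "h (axis i 1) x = (\<Sum>j\<in>UNIV. if j = i then x $ j else 0)"
    unfolding hermitian_form_def by (rule sum.cong) (auto simp: axis_def)
  then show ?thesis by simp
qed

lemma h_nondegenerate: "(\<And>y. h x y = 0) \<Longrightarrow> x = 0"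
  by (metis h_axis h_eq_0_commute vec_eq_iff zero_index)

lemma h_self_in_K: "h x x \<in> K"
  using h_commute[of x x] by (simp add: K_def)

lemma h_self_add: "h (x + y) (x + y) = h x x + h y y + tr (h x y)"
  using h_commute[of y x] by (simp add: h_linear tr_def)

lemma h_self_scale: "h (c *s x) (c *s x) = (c ^ t * c) * h x x"
  by (simp add: h_linear)

lemma h_self_add_scaled:
  "h (x + c *s y) (x + c *s y) = h x x + c ^ t * c * h y y + tr (c * h x y)"
  by (simp add: h_self_add h_scale_left hermitian_form_scale_right)

lemma linear_functional_eq_h:
  assumes "\<And>x y. \<phi> (x + y) = \<phi> x + \<phi> y" "\<And>c x. \<phi> (c *s x) = c * \<phi> x"
  obtains p where "\<And>x. \<phi> x = h p x"
proof
  fix x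
  have sum: "\<phi> (\<Sum>i\<in>I. f i) = (\<Sum>i\<in>I. \<phi> (f i))" for I :: "5 set" and f
    using assms(2)[of 0 0] by (induction I rule: infinite_finite_induct) (simp_all add: assms(1))
  have "\<phi> x = \<phi> (\<Sum>i\<in>UNIV. x $ i *s axis i 1)"
    by (simp add: basis_expansion)
  also have "\<dots> = h (\<chi> i. \<phi> (axis i 1) ^ t) x"
    by (simp add: sum assms(2) hermitian_form_def mult.commute)
  finally show "\<phi> x = h (\<chi> i. \<phi> (axis i 1) ^ t) x" .
qed

section \<open>Counting isotropic vectors by orthogonal decomposition\<close>

lemma cancel_t: "t * m = t * n \<Longrightarrow> m = n"
  and cancel_t2: "t\<^sup>2 * m = t\<^sup>2 * n \<Longrightarrow> m = n"
  and cancel_le_t2: "t\<^sup>2 * m \<le> t\<^sup>2 * n \<Longrightarrow> m \<le> n"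
  by simp_all

lemma card_vec5: "CARD('a ^ 5) = t ^ 10"
  by (simp add: card_field flip: power_mult)

lemma card_functional_kernel:
  assumes W: "vec.subspace W" and u: "u \<in> W" "h p u \<noteq> 0"
  shows "card W = t\<^sup>2 * card (W \<inter> perp t p)"
proof -
  have "bij_betw (\<lambda>(c, x). c *s u + x) (UNIV \<times> (W \<inter> perp t p)) W"
  proof (rule bij_betwI[of _ _ _ "\<lambda>x. (h p x / h p u, x - (h p x / h p u) *s u)"])
    show "(\<lambda>(c, x). c *s u + x) \<in> UNIV \<times> (W \<inter> perp t p) \<rightarrow> W"
      using W u by (auto intro: vec.subspace_add vec.subspace_scale)
    show "(\<lambda>x. (h p x / h p u, x - (h p x / h p u) *s u)) \<in> W \<rightarrow> UNIV \<times> (W \<inter> perp t p)"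
      using W u by (auto simp: perp_def h_linear intro: vec.subspace_diff vec.subspace_scale)
  qed (use u in \<open>auto simp: perp_def h_linear\<close>)
  then show ?thesis
    by (auto simp: bij_betw_same_card[symmetric] card_cartesian_product card_field)
qed

lemma card_perp:
  fixes p :: "'a ^ 5"
  assumes "p \<noteq> 0"
  shows "card (perp t p) = t ^ 8"
proof -
  obtain u where "h p u \<noteq> 0" using h_nondegenerate assms by blast
  then have "t\<^sup>2 * card (perp t p) = t\<^sup>2 * t ^ 8"
    using card_functional_kernel[of UNIV u p] card_vec5 by (simp flip: power_add)
  then show ?thesis by (rule cancel_t2)
qed

text \<open>\<open>W\<close> is the orthogonal sum of the line of \<open>p\<close> and
  \<open>W \<inter> perp t p\<close>. A vector \<open>c *s p + x\<close> is isotropic iff the norm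
  of \<open>c\<close> is \<open>- h x x / h p p\<close>: one solution if \<open>x\<close> is
  isotropic, t + 1 otherwise.\<close>

lemma card_isotropic_anisotropic_split:
  assumes W: "vec.subspace W" and p: "p \<in> W" "h p p \<noteq> 0"
  shows "card (isotropic t W) + t * card (isotropic t (W \<inter> perp t p)) = (t + 1) * card (W \<inter> perp t p)"
proof -
  let ?P = "W \<inter> perp t p" and ?D = "\<lambda>x. {c. c ^ t * c * h p p + h x x = 0}"
  have self: "h (c *s p + x) (c *s p + x) = c ^ t * c * h p p + h x x" if "x \<in> ?P" for c x
    using that h_self_add_scaled[of x c p] h_eq_0_commute[of p x] by (simp add: perp_def add.commute)
  have "bij_betw (\<lambda>(x, c). c *s p + x) (SIGMA x:?P. ?D x) (isotropic t W)"
  proof (rule bij_betwI[of _ _ _ "\<lambda>x. (x - (h p x / h p p) *s p, h p x / h p p)"])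
    show "(\<lambda>(x, c). c *s p + x) \<in> (SIGMA x:?P. ?D x) \<rightarrow> isotropic t W"
      using W p by (auto simp: isotropic_def self intro: vec.subspace_add vec.subspace_scale)
    show "(\<lambda>x. (x - (h p x / h p p) *s p, h p x / h p p)) \<in> isotropic t W \<rightarrow> (SIGMA x:?P. ?D x)"
    proof
      fix x assume x: "x \<in> isotropic t W"
      define c where "c = h p x / h p p"
      have P: "x - c *s p \<in> ?P"
        using W p x by (auto simp: perp_def h_linear c_def isotropic_def
            intro: vec.subspace_diff vec.subspace_scale)
      have "c ^ t * c * h p p + h (x - c *s p) (x - c *s p) = 0"
        using x self[OF P, of c] by (simp add: isotropic_def)
      then show "(x - (h p x / h p p) *s p, h p x / h p p) \<in> (SIGMA x:?P. ?D x)"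
        unfolding c_def[symmetric] using P by simp
    qed
  qed (use p in \<open>auto simp: perp_def h_linear\<close>)
  then have "card (isotropic t W) = card (SIGMA x:?P. ?D x)"
    by (rule bij_betw_same_card[symmetric])
  also have "\<dots> = (\<Sum>x\<in>?P. card (?D x))"
    by (rule card_SigmaI) auto
  also have "\<dots> + t * card (isotropic t ?P) = (\<Sum>x\<in>?P. card (?D x) + (if h x x = 0 then t else 0))"
    by (simp add: sum.distrib sum.If_cases isotropic_def Int_def)
  also have "\<dots> = (\<Sum>x\<in>?P. t + 1)"
  proof (rule sum.cong[OF refl])
    fix x
    show "card (?D x) + (if h x x = 0 then t else 0) = t + 1"
    proof (cases "h x x = 0")
      case True
      then have "?D x = {0}" using p t_ge_2 by auto
      then show ?thesis using True by simp
    next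
      case False
      have "?D x = {c. c ^ t * c = - h x x / h p p}"
        by (simp only: eq_neg_iff_add_eq_0[symmetric] nonzero_eq_divide_eq[OF p(2)])
      also have "card \<dots> = t + 1"
        unfolding divide_inverse using False p
        by (intro card_norm_fibre K_mult K_inverse K_minus h_self_in_K) simp
      finally show ?thesis using False by simp
    qed
  qed
  finally show ?thesis by simp
qed

text \<open>An isotropic \<open>p\<close> has no complement of this kind, so translations along
  \<open>p\<close> are used instead. For \<open>x\<close> outside \<open>perp t p\<close>, the value
  at \<open>x + c *s p\<close> is \<open>h x x + tr (c * h x p)\<close>, which vanishes for t of the
  t^2 scalars. Hence exactly one t-th of \<open>W - perp t p\<close> is isotropic.\<close>

lemma card_isotropic_isotropic_split:
  assumes W: "vec.subspace W" and p: "p \<in> W" "h p p = 0"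
  shows "t * card (isotropic t W) + card (W \<inter> perp t p) = card W + t * card (isotropic t (W \<inter> perp t p))"
proof -
  let ?P = "W \<inter> perp t p"
  let ?D = "W - perp t p"
  have "t\<^sup>2 * card (isotropic t ?D) = (\<Sum>c\<in>(UNIV::'a set). card (isotropic t ?D))"
    by (simp add: card_field)
  also have "\<dots> = (\<Sum>c\<in>UNIV. card {x \<in> ?D. h (x + c *s p) (x + c *s p) = 0})"
  proof (rule sum.cong[OF refl])
    fix c
    have "bij_betw (\<lambda>x. x + c *s p) {x \<in> ?D. h (x + c *s p) (x + c *s p) = 0} (isotropic t ?D)"
      using W p by (intro bij_betwI[of _ _ _ "\<lambda>x. x - c *s p"])
        (auto simp: isotropic_def perp_def h_linear
          intro: vec.subspace_add vec.subspace_diff vec.subspace_scale)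
    then show "card (isotropic t ?D) = card {x \<in> ?D. h (x + c *s p) (x + c *s p) = 0}"
      by (rule bij_betw_same_card[symmetric])
  qed
  also have "\<dots> = (\<Sum>x\<in>?D. card {c \<in> UNIV. h (x + c *s p) (x + c *s p) = 0})"
    by (rule sum_multicount_gen) auto
  also have "\<dots> = (\<Sum>x\<in>?D. t)"
  proof (rule sum.cong[OF refl])
    fix x assume x: "x \<in> ?D"
    then have "h x p \<noteq> 0" using h_eq_0_commute by (auto simp: perp_def)
    moreover have "{c \<in> UNIV. h (x + c *s p) (x + c *s p) = 0} = {c. tr (c * h x p) = - h x x}"
      using p by (auto simp: h_self_add_scaled add_eq_0_iff)
    ultimately show "card {c \<in> UNIV. h (x + c *s p) (x + c *s p) = 0} = t"
      using h_self_in_K K_minus by (simp add: card_tr_scale_fibre)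
  qed
  finally have D: "t * card (isotropic t ?D) = card ?D"
    using t_ge_2 by (simp add: power2_eq_square)
  have "card W = card ?D + card ?P"
    by (subst card_Un_disjoint[symmetric]) (auto intro: arg_cong[where f = card])
  moreover have "card (isotropic t W) = card (isotropic t ?D) + card (isotropic t ?P)"
    by (subst card_Un_disjoint[symmetric]) (auto simp: isotropic_def intro: arg_cong[where f = card])
  ultimately show ?thesis using D by (simp add: algebra_simps)
qed

text \<open>A new unit vector has norm 1 and is split off, so the counts satisfy I(n+1) = (t+1)
  t^(2n) - t I(n). The closed form solves this recursion; its alternating sign is the reason for
  working in the integers.\<close>

lemma card_isotropic_coordinate_subspace:
  fixes I :: "5 set"
  defines "W \<equiv> \<lambda>I. {v :: 'a ^ 5. \<forall>i. i \<notin> I \<longrightarrow> v $ i = 0}"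
  shows "card (W I) = t ^ (2 * card I) \<and>
    int t * int (card (isotropic t (W I))) = int t ^ (2 * card I) + (int t - 1) * (- int t) ^ card I"
proof (induction I rule: finite_induct[OF finite])
  case 1
  have "W {} = {0}" by (auto simp: W_def vec_eq_iff)
  moreover have "isotropic t {0 :: 'a ^ 5} = {0}" by (auto simp: isotropic_def)
  ultimately show ?case by simp
next
  case (2 i I)
  let ?e = "axis i 1 :: 'a ^ 5"
  have W: "vec.subspace (W (insert i I))" by (auto simp: vec.subspace_def W_def)
  have e: "?e \<in> W (insert i I)" by (simp add: axis_def W_def)
  have e1: "h ?e ?e = 1" by (simp only: h_axis) (simp add: axis_def)
  have P: "W (insert i I) \<inter> perp t ?e = W I"
    using 2 by (auto simp: perp_def h_axis W_def)
  have "card (W (insert i I)) = t\<^sup>2 * card (W I)"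
    using card_functional_kernel[OF W e, of ?e] e1 P by simp
  then have card: "card (W (insert i I)) = t ^ (2 * card (insert i I))"
    using 2 by (simp add: power_add power2_eq_square)
  have "card (isotropic t (W (insert i I))) + t * card (isotropic t (W I)) = (t + 1) * t ^ (2 * card I)"
    using card_isotropic_anisotropic_split[OF W e] e1 P 2 by simp
  then have "int (card (isotropic t (W (insert i I)))) + int t * int (card (isotropic t (W I))) =
      (int t + 1) * int t ^ (2 * card I)"
    by (metis of_nat_1 of_nat_add of_nat_mult of_nat_power)
  then have "int (card (isotropic t (W (insert i I)))) =
      (int t + 1) * int t ^ (2 * card I) - (int t ^ (2 * card I) + (int t - 1) * (- int t) ^ card I)"
    using 2 by linarith
  then have "int t * int (card (isotropic t (W (insert i I)))) = int t *
      ((int t + 1) * int t ^ (2 * card I) - (int t ^ (2 * card I) + (int t - 1) * (- int t) ^ card I))"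
    by (rule arg_cong)
  also have "\<dots> = int t ^ (2 * card (insert i I)) + (int t - 1) * (- int t) ^ card (insert i I)"
    using 2(1,2) by (simp add: algebra_simps power2_eq_square)
  finally show ?case
    using card by simp
qed

lemma card_isotropic_UNIV: "card (isotropic t (UNIV :: ('a ^ 5) set)) + t ^ 5 = t ^ 9 + t ^ 4"
proof -
  have "int t * int (card (isotropic t (UNIV :: ('a ^ 5) set))) =
      int t ^ 10 + (int t - 1) * (- int t) ^ 5"
    using card_isotropic_coordinate_subspace[of UNIV] by simp
  also have "\<dots> = int t * (int t ^ 9 + int t ^ 4 - int t ^ 5)"
    by (simp add: algebra_simps eval_nat_numeral)
  finally have "int (card (isotropic t (UNIV :: ('a ^ 5) set)) + t ^ 5) = int (t ^ 9 + t ^ 4)"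
    using t_ge_2 by simp
  then show ?thesis by (simp only: of_nat_eq_iff)
qed

lemma card_isotropic_nontangent:
  assumes "h p p \<noteq> 0"
  shows "card (isotropic t (perp t p)) + t ^ 3 = t ^ 7 + t ^ 4"
proof -
  have "p \<noteq> 0" using assms by auto
  then have "card (isotropic t (UNIV :: ('a ^ 5) set)) + t * card (isotropic t (perp t p)) = (t + 1) * t ^ 8"
    using card_isotropic_anisotropic_split[of UNIV p] assms card_perp[of p] by simp
  then have "t * (card (isotropic t (perp t p)) + t ^ 3) = t * (t ^ 7 + t ^ 4)"
    using card_isotropic_UNIV by (simp add: algebra_simps eval_nat_numeral)
  then show ?thesis by (rule cancel_t)
qed

lemma card_isotropic_tangent:
  assumes "h p p = 0" "p \<noteq> 0"
  shows "card (isotropic t (perp t p)) + t ^ 5 = t ^ 7 + t ^ 4"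
proof -
  have "t * card (isotropic t (UNIV :: ('a ^ 5) set)) + t ^ 8 = t ^ 10 + t * card (isotropic t (perp t p))"
    using card_isotropic_isotropic_split[of UNIV p] assms card_perp[of p] card_vec5 by simp
  moreover have "t * card (isotropic t (UNIV :: ('a ^ 5) set)) + t * t ^ 5 = t * (t ^ 9 + t ^ 4)"
    by (simp only: card_isotropic_UNIV flip: distrib_left)
  ultimately have "t * (card (isotropic t (perp t p)) + t ^ 5) = t * (t ^ 7 + t ^ 4)"
    by (simp add: algebra_simps eval_nat_numeral)
  then show ?thesis by (rule cancel_t)
qed

section \<open>Sections by two hyperplanes\<close>

lemma card_perp_Int_perp:
  fixes p p' :: "'a ^ 5"
  assumes "p \<noteq> 0" "u \<in> perp t p" "u \<notin> perp t p'"
  shows "card (perp t p \<inter> perp t p') = t ^ 6"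
proof -
  have "t\<^sup>2 * card (perp t p \<inter> perp t p') = t\<^sup>2 * t ^ 6"
    using card_functional_kernel[OF subspace_perp assms(2), of p'] assms card_perp[of p]
    by (simp add: perp_def flip: power_add)
  then show ?thesis by (rule cancel_t2)
qed

text \<open>The Gram-Schmidt step: the component of \<open>p'\<close> orthogonal to
  \<open>p\<close>. It cuts out the same plane of \<open>perp t p\<close> as \<open>p'\<close> and
  lies in \<open>perp t p\<close> itself, so its norm decides the type of the section.\<close>

definition ortho :: "'a ^ 5 \<Rightarrow> 'a ^ 5 \<Rightarrow> 'a ^ 5" where
  "ortho p p' = p' - (h p p' / h p p) *s p"

lemma perp_Int_perp_ortho: "perp t p \<inter> perp t (ortho p p') = perp t p \<inter> perp t p'"
  by (auto simp: perp_def ortho_def h_linear)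

lemma ortho_in_perp: "h p p \<noteq> 0 \<Longrightarrow> ortho p p' \<in> perp t p"
  by (simp add: perp_def ortho_def h_linear)

text \<open>Within \<open>perp t p\<close> the plane is the polar of \<open>ortho p p'\<close>, so
  one of the two splitting lemmas applies. In points, the section has t^3 + 1 points in the
  nonsingular case and t^3 + t^2 + 1, as for t + 1 concurrent lines, in the singular one.\<close>

lemma card_isotropic_pair:
  assumes p: "h p p \<noteq> 0" and u: "u \<in> perp t p" "u \<notin> perp t p'"
  shows "card (isotropic t (perp t p \<inter> perp t p')) + t ^ 3 =
    t ^ 5 + (if h (ortho p p') (ortho p p') = 0 then t ^ 4 else t ^ 2)"
proof -
  let ?r = "ortho p p'" and ?P = "perp t p \<inter> perp t p'"
  have "p \<noteq> 0" using p by auto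
  then have card: "card ?P = t ^ 6" "card (perp t p) = t ^ 8"
    using u by (auto simp: card_perp_Int_perp card_perp)
  note perp = subspace_perp ortho_in_perp[OF p, of p']
  show ?thesis
  proof (cases "h ?r ?r = 0")
    case True
    have "t * card (isotropic t (perp t p)) + t ^ 6 = t ^ 8 + t * card (isotropic t ?P)"
      using card_isotropic_isotropic_split[OF perp True] card by (simp add: perp_Int_perp_ortho)
    moreover have "t * card (isotropic t (perp t p)) + t * t ^ 3 = t * (t ^ 7 + t ^ 4)"
      by (simp only: card_isotropic_nontangent[OF p] flip: distrib_left)
    ultimately have "t * (card (isotropic t ?P) + t ^ 3) = t * (t ^ 5 + t ^ 4)"
      by (simp add: algebra_simps eval_nat_numeral)
    then have "card (isotropic t ?P) + t ^ 3 = t ^ 5 + t ^ 4"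
      by (rule cancel_t)
    then show ?thesis using True by simp
  next
    case False
    have "card (isotropic t (perp t p)) + t * card (isotropic t ?P) = (t + 1) * t ^ 6"
      using card_isotropic_anisotropic_split[OF perp False] card by (simp add: perp_Int_perp_ortho)
    then have "t * (card (isotropic t ?P) + t ^ 3) = t * (t ^ 5 + t ^ 2)"
      using card_isotropic_nontangent[OF p] by (simp add: algebra_simps eval_nat_numeral)
    then have "card (isotropic t ?P) + t ^ 3 = t ^ 5 + t ^ 2"
      by (rule cancel_t)
    then show ?thesis using False by simp
  qed
qed

lemma card_isotropic_Un:
  "card (isotropic t (A \<union> B)) + card (isotropic t (A \<inter> B)) =
    card (isotropic t A) + card (isotropic t (B :: ('a ^ 5) set))"
proof -
  have "isotropic t (A \<union> B) = isotropic t A \<union> isotropic t B" "isotropic t (A \<inter> B) = isotropic t A \<inter> isotropic t B"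
    by (auto simp: isotropic_def)
  then show ?thesis
    using card_Un_Int[of "isotropic t A" "isotropic t B"] by simp
qed

lemma card_isotropic_pair_nontangent:
  assumes "h p p \<noteq> 0" "h p' p' \<noteq> 0" "u \<in> perp t p" "u \<notin> perp t p'"
  shows "card (isotropic t (perp t p \<union> perp t p')) + t ^ 5 + t ^ 3 =
    2 * t ^ 7 + 2 * t ^ 4 - (if h (ortho p p') (ortho p p') = 0 then t ^ 4 else t ^ 2)"
  using card_isotropic_Un[of "perp t p" "perp t p'"] card_isotropic_pair[OF assms(1,3,4)]
    card_isotropic_nontangent[OF assms(1)] card_isotropic_nontangent[OF assms(2)]
  by simp

lemma card_isotropic_pair_tangent_nontangent:
  assumes "h p p \<noteq> 0" "h p' p' = 0" "p' \<noteq> 0" "u \<in> perp t p" "u \<notin> perp t p'"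
  shows "card (isotropic t (perp t p \<union> perp t p')) + 2 * t ^ 5 =
    2 * t ^ 7 + 2 * t ^ 4 - (if h (ortho p p') (ortho p p') = 0 then t ^ 4 else t ^ 2)"
  using card_isotropic_Un[of "perp t p" "perp t p'"] card_isotropic_pair[OF assms(1,4,5)]
    card_isotropic_nontangent[OF assms(1)] card_isotropic_tangent[OF assms(2,3)]
  by simp

text \<open>By inclusion and exclusion it suffices that the common plane has more than t^2 isotropic
  vectors. If \<open>p\<close> and \<open>p'\<close> are orthogonal, \<open>p'\<close> lies in
  \<open>perp t p\<close> and the splitting gives t^4 of them.\<close>

lemma card_isotropic_pair_tangent:
  assumes p: "h p p = 0" "p \<noteq> 0" and p': "h p' p' = 0" "p' \<noteq> 0"
    and u: "u \<in> perp t p" "u \<notin> perp t p'"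
  shows "card (isotropic t (perp t p \<union> perp t p')) + 2 * t ^ 5 + t ^ 2 < 2 * t ^ 7 + 2 * t ^ 4"
proof -
  have "t ^ 2 < card (isotropic t (perp t p \<inter> perp t p'))"
  proof (cases "h p p' = 0")
    case True
    then have "p' \<in> perp t p" by (simp add: perp_def)
    then have "t * card (isotropic t (perp t p)) + t ^ 6 =
        t ^ 8 + t * card (isotropic t (perp t p \<inter> perp t p'))"
      using card_isotropic_isotropic_split[OF subspace_perp[of t p] _ p'(1)] p(2) u card_perp[of p]
      by (simp add: card_perp_Int_perp)
    moreover have "t * card (isotropic t (perp t p)) + t * t ^ 5 = t * (t ^ 7 + t ^ 4)"
      by (simp only: card_isotropic_tangent[OF p] flip: distrib_left)
    ultimately have "t * card (isotropic t (perp t p \<inter> perp t p')) = t * t ^ 4"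
      by (simp add: algebra_simps eval_nat_numeral)
    then show ?thesis using t_ge_2 by (simp add: power_strict_increasing)
  next
    case False
    text \<open>The plane also lies in a non-tangent hyperplane.\<close>
    obtain c where c: "tr (c * h p p') \<noteq> 0"
      using tr_scale_eq_0 False by blast
    define r where "r = p + c *s p'"
    have r: "h r r \<noteq> 0"
      using c p p' by (simp add: r_def h_self_add_scaled)
    \<comment> \<open>The coefficient makes the two terms of \<open>h r v\<close> cancel, while
      \<open>h p' v = h p' p\<close> stays nonzero.\<close>
    define v where "v = p - (c ^ t * h p' p / h p p') *s p'"
    have "v \<in> perp t r" "v \<notin> perp t p'"
      using False p p' h_eq_0_commute[of p p'] by (simp_all add: v_def r_def perp_def h_linear)
    moreover have "perp t r \<inter> perp t p' = perp t p \<inter> perp t p'"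
      by (auto simp: perp_def r_def h_linear)
    ultimately have "card (isotropic t (perp t p \<inter> perp t p')) + t ^ 3 \<ge> t ^ 5 + t ^ 2"
      using card_isotropic_pair[OF r, of v p'] t_ge_2 by (simp add: power_increasing)
    moreover have "t ^ 3 < t ^ 5"
      using t_ge_2 by (simp add: power_strict_increasing)
    ultimately show ?thesis by linarith
  qed
  then show ?thesis
    using card_isotropic_Un[of "perp t p" "perp t p'"] card_isotropic_tangent[OF p]
      card_isotropic_tangent[OF p'] by linarith
qed

end

section \<open>Quadrics meeting the hermitian variety\<close>

locale quadric_section = square_field t field_type
  for t :: nat and field_type :: "'a::{field,finite} itself" +
  fixes F :: "'a ^ 5 \<Rightarrow> 'a"
  assumes quadratic_F: "quadratic_form UNIV F"
begin

sublocale F: quadratic_form UNIV F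
  by (rule quadratic_F)

definition twist :: "'a \<Rightarrow> 'a ^ 5 \<Rightarrow> 'a" where
  "twist b x = h x x + tr (b * F x)"

lemma polar_twist: "polar (twist b) x y = tr (h x y + b * polar F x y)"
  by (simp add: polar_def twist_def h_self_add tr_add tr_diff algebra_simps)

lemma quadratic_twist: "quadratic_form K (twist b)"
proof
  show "twist b x \<in> K" for x
    by (simp add: twist_def K_add h_self_in_K)
  show "twist b (a *s x) = a\<^sup>2 * twist b x" if a: "a \<in> K" for a x
  proof -
    have "a ^ t * a = a\<^sup>2" using a by (simp add: K_def power2_eq_square)
    moreover have "tr (b * (a\<^sup>2 * F x)) = a\<^sup>2 * tr (b * F x)"
      using a tr_scale[of "a\<^sup>2" "b * F x"] by (simp add: K_mult power2_eq_square mult.left_commute)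
    ultimately show ?thesis
      by (simp add: twist_def h_self_scale F.g_scale distrib_left)
  qed
  show "polar (twist b) (x + y) z = polar (twist b) x z + polar (twist b) y z" for x y z
    by (simp add: polar_twist h_add_left F.polar_add tr_add[symmetric] algebra_simps)
  show "polar (twist b) (a *s x) y = a * polar (twist b) x y" if a: "a \<in> K" for a x y
  proof -
    have "a ^ t = a" using a by (simp add: K_def)
    then have "h (a *s x) y + b * polar F (a *s x) y = a * (h x y + b * polar F x y)"
      by (simp add: h_scale_left F.polar_scale algebra_simps)
    then show ?thesis by (simp add: polar_twist tr_scale[OF a])
  qed
qed (simp_all add: K_add K_minus K_mult K_inverse)

sublocale twist: quadratic_form K "twist b" for b
  by (rule quadratic_twist)

text \<open>
  The radical \<open>R\<close> consists of the solutions of a semilinear equation, so \<open>R + e R\<close> is a direct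
  sum for every \<open>e\<close> outside \<open>K\<close>.
\<close>

lemma card_radical_twist: "card (twist.radical b UNIV) \<le> t ^ 5"
proof -
  let ?R = "twist.radical b UNIV"
  have "K \<noteq> UNIV"
    using card_K card_field t_ge_2 by (auto simp: power2_eq_square)
  then obtain e :: 'a where e: "e ^ t \<noteq> e" by (auto simp: K_def)
  \<comment> \<open>The radical condition only says that a trace vanishes. Testing it on all
    multiples of \<open>z\<close> by the large field removes the trace.\<close>
  have R: "h x z + b * polar F x z = 0" if "x \<in> ?R" for x z
  proof (rule tr_scale_eq_0)
    fix c
    have "polar (twist b) x (c *s z) = 0"
      using that by (simp add: twist.radical_def)
    then show "tr (c * (h x z + b * polar F x z)) = 0"
      by (simp add: polar_twist hermitian_form_scale_right F.polar_scale_right algebra_simps)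
  qed
  have "inj_on (\<lambda>(x, y). x + e *s y) (?R \<times> ?R)"
  proof (rule inj_onI, clarify)
    fix x y x' y' assume *: "x \<in> ?R" "y \<in> ?R" "x' \<in> ?R" "y' \<in> ?R" "x + e *s y = x' + e *s y'"
    have diff: "x - x' \<in> ?R" "y - y' \<in> ?R"
      using * by (auto intro: twist.subsp_diff twist.subsp_radical twist.subsp_UNIV)
    have eq: "x - x' = (- e) *s (y - y')"
      using *(5) by (simp add: algebra_simps vec.scale_right_diff_distrib)
    \<comment> \<open>The scalar \<open>e\<close> leaves \<open>h\<close> as \<open>e ^ t\<close>
      but leaves the polar of \<open>F\<close> as \<open>e\<close>. Comparing the two radical
      equations gives the factor \<open>e - e ^ t\<close>, which is nonzero.\<close>
    have "h (y - y') z = 0" for z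
    proof -
      have "- (e ^ t) * h (y - y') z + b * (- e * polar F (y - y') z) = 0"
        using R[OF diff(1), of z] unfolding eq
        by (simp only: h_scale_left F.polar_scale[OF UNIV_I] conj_minus)
      moreover have "b * polar F (y - y') z = - h (y - y') z"
        using R[OF diff(2), of z] by (simp add: add_eq_0_iff)
      then have "b * (- e * polar F (y - y') z) = e * h (y - y') z"
        by (simp only: mult.left_commute[of b]) simp
      ultimately have "(e - e ^ t) * h (y - y') z = 0"
        by (simp only: left_diff_distrib) simp
      then show ?thesis using e by simp
    qed
    then have "y = y'" using h_nondegenerate by force
    then show "x = x' \<and> y = y'" using *(5) by simp
  qed
  then have "card (?R \<times> ?R) \<le> card (UNIV :: ('a ^ 5) set)"
    by (intro card_inj_on_le) auto
  then have "(card ?R)\<^sup>2 \<le> (t ^ 5)\<^sup>2"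
    by (simp only: card_cartesian_product card_vec5 power2_eq_square flip: power_add) simp
  then show ?thesis by (rule power2_le_imp_le) simp
qed

lemma card_zeros_twist: "t * card (twist.zeros b UNIV) \<le> t ^ 10 + (t - 1) * t ^ 7"
proof -
  have "card (UNIV :: ('a ^ 5) set) = card K ^ 10"
    by (simp only: card_K card_vec5)
  from twist.card_zeros_le[where b = b and r = 5, OF twist.subsp_UNIV this]
  show ?thesis
    using card_radical_twist[of b] by (simp add: card_K)
qed

text \<open>For \<open>x\<close> in Z the condition does not involve \<open>b\<close> and holds for
  all t^2 scalars or for none. Off Z it prescribes the trace of \<open>b * F x\<close>, which
  exactly t scalars satisfy, isotropic or not.\<close>

lemma sum_card_zeros_twist:
  "(\<Sum>b\<in>UNIV. card (twist.zeros b UNIV)) =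
    t\<^sup>2 * card (isotropic t (F.zeros UNIV)) + t * card (- F.zeros UNIV)"
proof -
  have "(\<Sum>b\<in>UNIV. card (twist.zeros b UNIV)) = (\<Sum>b\<in>UNIV. card {x \<in> UNIV. twist b x = 0})"
    by (simp add: twist.zeros_def)
  also have "\<dots> = (\<Sum>x\<in>UNIV. card {b \<in> UNIV. twist b x = 0})"
    by (rule sum_multicount_gen) auto
  also have "\<dots> = (\<Sum>x\<in>UNIV. (if x \<in> isotropic t (F.zeros UNIV) then t\<^sup>2 else 0) +
      (if x \<in> - F.zeros UNIV then t else 0))"
  proof (rule sum.cong[OF refl])
    fix x
    show "card {b \<in> UNIV. twist b x = 0} = (if x \<in> isotropic t (F.zeros UNIV) then t\<^sup>2 else 0) +
      (if x \<in> - F.zeros UNIV then t else 0)"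
    proof (cases "F x = 0")
      case True
      then show ?thesis
        by (simp add: twist_def isotropic_def F.zeros_def card_field)
    next
      case False
      have "{b \<in> UNIV. twist b x = 0} = {b. tr (b * F x) = - h x x}"
        by (auto simp: twist_def add_eq_0_iff)
      then show ?thesis
        using False by (simp add: isotropic_def F.zeros_def card_tr_scale_fibre K_minus h_self_in_K)
    qed
  qed
  also have "\<dots> = t\<^sup>2 * card (isotropic t (F.zeros UNIV)) + t * card (- F.zeros UNIV)"
    by (simp add: sum.distrib sum.If_cases Collect_neg_eq)
  finally show ?thesis .
qed

lemma card_isotropic_quadric_bound:
  assumes Z: "card (F.zeros UNIV) \<le> t ^ 8 + t ^ 6"
  shows "card (isotropic t (F.zeros UNIV)) + 2 * t ^ 5 + t\<^sup>2 < 2 * t ^ 7 + 2 * t ^ 4"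
proof (rule ccontr)
  let ?A = "card (isotropic t (F.zeros UNIV))" and ?Z = "card (F.zeros UNIV)"
  define A where "A = int ?A"
  define Z where "Z = int ?Z"
  define s where "s = int t"
  have s: "s \<ge> 2" using t_ge_2 by (simp add: s_def)
  have t1: "int (t - 1) = s - 1" using t_ge_2 by (simp add: s_def)
  assume "\<not> ?thesis"
  then have "2 * t ^ 7 + 2 * t ^ 4 \<le> ?A + 2 * t ^ 5 + t\<^sup>2" by simp
  then have "int (2 * t ^ 7 + 2 * t ^ 4) \<le> int (?A + 2 * t ^ 5 + t\<^sup>2)"
    by (simp only: of_nat_le_iff)
  then have A: "2 * s ^ 7 + 2 * s ^ 4 - 2 * s ^ 5 - s\<^sup>2 \<le> A"
    by (simp add: A_def s_def)
  have "int ?Z \<le> int (t ^ 8 + t ^ 6)"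
    using Z by (simp only: of_nat_le_iff)
  then have Z': "Z \<le> s ^ 8 + s ^ 6" by (simp add: Z_def s_def)
  have card_compl: "int (card (- F.zeros UNIV)) = s ^ 10 - Z"
  proof -
    have "card (- F.zeros UNIV) + ?Z = t ^ 10"
      using card_Un_disjoint[of "- F.zeros UNIV" "F.zeros UNIV"] card_vec5
      by (simp add: Compl_partition2)
    then have "int (card (- F.zeros UNIV) + ?Z) = int (t ^ 10)" by (simp only:)
    then show ?thesis by (simp add: s_def Z_def)
  qed
  \<comment> \<open>At \<open>b = 0\<close> the twisted form is the hermitian form itself, whose
    exact count is smaller than the general bound.\<close>
  have "twist.zeros 0 UNIV = isotropic t UNIV"
    by (simp add: twist.zeros_def isotropic_def twist_def)
  then have zero: "card (twist.zeros 0 UNIV) + t ^ 5 = t ^ 9 + t ^ 4"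
    using card_isotropic_UNIV by simp
  have "t * (\<Sum>b\<in>UNIV - {0}. card (twist.zeros b UNIV)) \<le>
      (\<Sum>b\<in>UNIV - {0::'a}. t ^ 10 + (t - 1) * t ^ 7)"
    unfolding sum_distrib_left by (rule sum_mono) (rule card_zeros_twist)
  also have "\<dots> = (t\<^sup>2 - 1) * (t ^ 10 + (t - 1) * t ^ 7)"
    by (simp add: card_field)
  finally have nonzero: "t * (\<Sum>b\<in>UNIV - {0}. card (twist.zeros b UNIV)) \<le>
      (t\<^sup>2 - 1) * (t ^ 10 + (t - 1) * t ^ 7)" .
  have "t\<^sup>2 * ?A + t * card (- F.zeros UNIV) =
      card (twist.zeros 0 UNIV) + (\<Sum>b\<in>UNIV - {0}. card (twist.zeros b UNIV))"
    unfolding sum_card_zeros_twist[symmetric] by (rule sum.remove) auto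
  then have "t * (t\<^sup>2 * ?A + t * card (- F.zeros UNIV)) + t * t ^ 5 \<le>
      t * (t ^ 9 + t ^ 4) + (t\<^sup>2 - 1) * (t ^ 10 + (t - 1) * t ^ 7)"
    using nonzero unfolding zero[symmetric] by (simp add: distrib_left)
  then have "int (t * (t\<^sup>2 * ?A + t * card (- F.zeros UNIV)) + t * t ^ 5) \<le>
      int (t * (t ^ 9 + t ^ 4) + (t\<^sup>2 - 1) * (t ^ 10 + (t - 1) * t ^ 7))"
    by (simp only: of_nat_le_iff)
  moreover have "int (t\<^sup>2 - 1) = s\<^sup>2 - 1"
    using t_ge_2 by (simp add: s_def of_nat_diff)
  ultimately have main: "s * (s\<^sup>2 * A + s * (s ^ 10 - Z)) + s * s ^ 5 \<le>
      s * (s ^ 9 + s ^ 4) + (s\<^sup>2 - 1) * (s ^ 10 + (s - 1) * s ^ 7)"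
    by (simp only: of_nat_add of_nat_mult of_nat_power card_compl t1 s_def[symmetric] A_def[symmetric])
  have "s\<^sup>2 * Z \<le> s\<^sup>2 * (s ^ 8 + s ^ 6)"
    using Z' by (intro mult_left_mono) auto
  moreover have "s ^ 3 * (2 * s ^ 7 + 2 * s ^ 4 - 2 * s ^ 5 - s\<^sup>2) \<le> s ^ 3 * A"
    using A s by (intro mult_left_mono) auto
  ultimately have "s ^ 9 - 2 * s ^ 8 + s ^ 7 + s ^ 6 - 2 * s ^ 5 \<le> 0"
    using main by (simp add: algebra_simps eval_nat_numeral)
  \<comment> \<open>The square keeps the bracket positive at s = 2 as well, where the other summand
    vanishes.\<close>
  also have "s ^ 9 - 2 * s ^ 8 + s ^ 7 + s ^ 6 - 2 * s ^ 5 = s ^ 5 * ((s * (s - 1))\<^sup>2 + (s - 2))"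
    by (simp add: algebra_simps eval_nat_numeral)
  finally have "(s * (s - 1))\<^sup>2 + (s - 2) \<le> 0"
    using s by (simp add: mult_le_0_iff)
  moreover have "(s * (s - 1))\<^sup>2 > 0" using s by simp
  ultimately show False using s by linarith
qed

text \<open>A zero set inside a proper subspace is small. Otherwise a hyperbolic plane splits off,
  and everything depends on whether \<open>F\<close> vanishes on its complement: if so,
  \<open>F\<close> is a product of two independent linear forms. The vectors \<open>u\<close> and
  \<open>u'\<close> record that neither hyperplane contains the other.\<close>

lemma quadric_trichotomy:
  obtains (zero) "\<And>x. F x = 0"
  | (pair) p p' u u' where "F.zeros UNIV = perp t p \<union> perp t p'"
      "u \<in> perp t p" "u \<notin> perp t p'" "u' \<in> perp t p'" "u' \<notin> perp t p"
  | (small) "card (F.zeros UNIV) \<le> t ^ 8 + t ^ 6"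
proof (cases "F.zeros UNIV \<subseteq> F.radical UNIV")
  case True
  have le: "card (F.zeros UNIV) \<le> t ^ 8 + t ^ 6"
    if U: "F.subsp U" "U \<noteq> UNIV" "F.zeros UNIV \<subseteq> U" for U
  proof -
    have "t\<^sup>2 * card U \<le> t\<^sup>2 * t ^ 8"
      using F.card_proper_subsp[OF U(1) F.subsp_UNIV] U(2) card_vec5
      by (auto simp: card_field simp flip: power_add)
    then have "card U \<le> t ^ 8" by (rule cancel_le_t2)
    moreover have "card (F.zeros UNIV) \<le> card U"
      using U(3) by (intro card_mono) auto
    ultimately show ?thesis by linarith
  qed
  show thesis
  proof (cases "F.radical UNIV = UNIV")
    case True
    \<comment> \<open>\<open>F\<close> is now additive, which for nonzero \<open>F\<close> happens
      only in characteristic 2; its zeros form a subspace.\<close>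
    then have "polar F x y = 0" for x y by (auto simp: F.radical_def)
    then have "F.subsp (F.zeros UNIV)"
      by (simp add: F.subsp_def F.zeros_def polar_expand[of F] F.g_scale)
    then show thesis using le zero small by (auto simp: F.zeros_def)
  next
    case False
    then show thesis using le[OF F.subsp_radical[OF F.subsp_UNIV]] \<open>F.zeros UNIV \<subseteq> _\<close> small by blast
  qed
next
  case False
  then obtain v u where v: "F v = 0" and u: "polar F v u \<noteq> 0"
    by (auto simp: F.zeros_def F.radical_def)
  then obtain w where w: "F w = 0" "polar F v w \<noteq> 0"
    using F.singular_partner[OF F.subsp_UNIV] by blast
  note split = F.subsp_UNIV UNIV_I v UNIV_I w
  let ?P = "F.pair_perp v w UNIV"
  have "t\<^sup>2 * (t\<^sup>2 * card ?P) = t\<^sup>2 * (t\<^sup>2 * t ^ 6)"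
    using F.card_hyperbolic_split[OF split] card_vec5
    by (simp add: card_field power2_eq_square[of "t\<^sup>2"] flip: power_add)
  then have P: "card ?P = t ^ 6" by (rule cancel_t2[OF cancel_t2])
  show thesis
  proof (cases "\<forall>y\<in>?P. F y = 0")
    case True
    have vv: "polar F v v = 0" "polar F w w = 0" "polar F w v = polar F v w"
      using v w F.polar_self by (simp_all add: polar_commute)
    obtain p where p: "\<And>x. polar F v x = h p x"
      using linear_functional_eq_h[of "polar F v"] F.polar_add_right F.polar_scale_right by auto
    obtain p' where p': "\<And>x. polar F w x = h p' x"
      using linear_functional_eq_h[of "polar F w"] F.polar_add_right F.polar_scale_right by auto
    \<comment> \<open>\<open>F x\<close> is the product of the two hyperbolic coordinates up to a
      constant, and these coordinates are proportional to \<open>polar F w x\<close> and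
      \<open>polar F v x\<close>.\<close>
    have "F x = 0 \<longleftrightarrow> polar F v x = 0 \<or> polar F w x = 0" for x
    proof -
      obtain a b y where x: "x = a *s v + b *s w + y" "y \<in> ?P"
        using F.hyperbolic_splitE[OF split UNIV_I] by metis
      then have "F x = a * b * polar F v w"
        using F.g_hyperbolic_split[OF split, of a b y] True by simp
      moreover have "polar F v x = b * polar F v w" "polar F w x = a * polar F v w"
        using x vv by (simp_all add: F.polar_add_right F.polar_scale_right F.pair_perp_def)
      ultimately show ?thesis using w by auto
    qed
    then have "F.zeros UNIV = perp t p \<union> perp t p'"
      by (auto simp: F.zeros_def perp_def p p')
    moreover have "v \<in> perp t p" "v \<notin> perp t p'" "w \<in> perp t p'" "w \<notin> perp t p"
      using vv w by (simp_all add: perp_def flip: p p')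
    ultimately show thesis by (rule pair)
  next
    case False
    then obtain y where y: "y \<in> ?P" "F y \<noteq> 0" by blast
    have "t\<^sup>2 * card (F.zeros ?P) \<le> 2 * t ^ 6"
      using F.card_zeros_le_of_nonzero[OF F.subsp_pair_perp[OF F.subsp_UNIV] y] P
      by (simp add: card_field)
    \<comment> \<open>Origin of the bound: 2t^6 + (t^2 - 1) t^6 = t^8 + t^6.\<close>
    then have "card (F.zeros UNIV) \<le> 2 * t ^ 6 + (t\<^sup>2 - 1) * t ^ 6"
      using F.card_zeros_hyperbolic_split[OF split] P by (simp add: card_field)
    moreover obtain m where m: "t\<^sup>2 = Suc m"
      by (metis not0_implies_Suc power_not_zero t_neq_0)
    moreover have "t ^ 8 = Suc m * t ^ 6"
      unfolding m[symmetric] by (simp flip: power_add)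
    ultimately have "card (F.zeros UNIV) \<le> t ^ 8 + t ^ 6"
      by simp
    then show thesis by (rule small)
  qed
qed

end

section \<open>Forms of degree 2\<close>

lemma prod_power_sum_1:
  assumes "(\<Sum>i\<in>UNIV. m i) = (1::nat)"
  shows "\<exists>j. \<forall>v :: 'a::comm_ring_1 ^ 'n. (\<Prod>i\<in>UNIV. v $ i ^ m i) = v $ j"
proof -
  obtain j where j: "m j = 1" "\<And>i. i \<noteq> j \<Longrightarrow> m i = 0"
    using assms sum_eq_1_iff[of UNIV m] by auto
  have "(\<Prod>i\<in>UNIV. v $ i ^ m i) = v $ j" for v :: "'a ^ 'n"
  proof -
    have "(\<Prod>i\<in>UNIV. v $ i ^ m i) = (\<Prod>i\<in>UNIV. if i = j then v $ i else 1)"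
      by (rule prod.cong) (auto simp: j)
    then show ?thesis by simp
  qed
  then show ?thesis by blast
qed

text \<open>Each monomial becomes a product of two coordinates, possibly equal ones and chosen
  independently of \<open>v\<close>. Bilinearity of the polarization can then be checked term by
  term.\<close>

lemma prod_power_sum_2:
  assumes "(\<Sum>i\<in>UNIV. m i) = (2::nat)"
  shows "\<exists>i j. \<forall>v :: 'a::comm_ring_1 ^ 'n. (\<Prod>k\<in>UNIV. v $ k ^ m k) = v $ i * v $ j"
proof -
  obtain i where i: "m i \<noteq> 0"
    using assms by (metis sum.neutral zero_neq_numeral)
  define m' where "m' k = (if k = i then m k - 1 else m k)" for k
  have m: "m k = m' k + (if k = i then 1 else 0)" for k
    using i by (simp add: m'_def)
  have "(\<Sum>k\<in>UNIV. m' k) = 1"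
    using assms unfolding m by (simp add: sum.distrib)
  then have "\<exists>j. \<forall>v :: 'a ^ 'n. (\<Prod>k\<in>UNIV. v $ k ^ m' k) = v $ j"
    by (rule prod_power_sum_1)
  then obtain j where j: "\<And>v :: 'a ^ 'n. (\<Prod>k\<in>UNIV. v $ k ^ m' k) = v $ j"
    by blast
  have "(\<Prod>k\<in>UNIV. v $ k ^ m k) = v $ i * v $ j" for v :: "'a ^ 'n"
  proof -
    have "(\<Prod>k\<in>UNIV. v $ k ^ m k) = (\<Prod>k\<in>UNIV. v $ k ^ m' k) * (\<Prod>k\<in>UNIV. if k = i then v $ k else 1)"
      unfolding prod.distrib[symmetric] by (rule prod.cong) (auto simp: m)
    then show ?thesis by (simp add: j)
  qed
  then show ?thesis by blast
qed

lemma quadratic_form_eval: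
  fixes f :: "'a::{field,finite} poly5"
  assumes f: "f \<in> forms2"
  shows "quadratic_form UNIV (eval_poly5 f)"
proof -
  have "\<exists>i j. \<forall>v :: 'a ^ 5. (\<Prod>k\<in>UNIV. v $ k ^ Poly_Mapping.lookup m k) = v $ i * v $ j"
    if "m \<in> Poly_Mapping.keys f" for m
  proof -
    have "(\<Sum>i\<in>UNIV. Poly_Mapping.lookup m i) = 2"
      using f that by (simp add: forms2_def)
    then show ?thesis by (rule prod_power_sum_2)
  qed
  then obtain i j where ij: "\<And>m v. m \<in> Poly_Mapping.keys f \<Longrightarrow>
      (\<Prod>k\<in>UNIV. (v :: 'a ^ 5) $ k ^ Poly_Mapping.lookup m k) = v $ i m * v $ j m"
    by metis
  have eval: "eval_poly5 f v = (\<Sum>m\<in>Poly_Mapping.keys f. Poly_Mapping.lookup f m * (v $ i m * v $ j m))" for v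
    unfolding eval_poly5_def by (rule sum.cong) (simp_all add: ij)
  have polar: "polar (eval_poly5 f) x y =
      (\<Sum>m\<in>Poly_Mapping.keys f. Poly_Mapping.lookup f m * (x $ i m * y $ j m + y $ i m * x $ j m))" for x y
    unfolding polar_def eval sum_subtractf[symmetric] by (rule sum.cong) (simp_all add: algebra_simps)
  show ?thesis
  proof
    show "polar (eval_poly5 f) (x + y) z = polar (eval_poly5 f) x z + polar (eval_poly5 f) y z" for x y z
      unfolding polar sum.distrib[symmetric] by (rule sum.cong) (simp_all add: algebra_simps)
    show "polar (eval_poly5 f) (a *s x) y = a * polar (eval_poly5 f) x y" for a x y
      unfolding polar sum_distrib_left by (rule sum.cong) (simp_all add: algebra_simps)
  qed (simp_all add: eval_poly5_scale[OF f])
qed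

lemma eval_poly5_superset:
  assumes "finite A" "Poly_Mapping.keys f \<subseteq> A"
  shows "eval_poly5 f v =
    (\<Sum>m\<in>A. Poly_Mapping.lookup f m * (\<Prod>i\<in>UNIV. v $ i ^ Poly_Mapping.lookup m i))"
  unfolding eval_poly5_def by (rule sum.mono_neutral_left) (use assms in \<open>auto simp: in_keys_iff\<close>)

lemma eval_poly5_add: "eval_poly5 (f + g) v = eval_poly5 f v + eval_poly5 g v"
proof -
  let ?A = "Poly_Mapping.keys f \<union> Poly_Mapping.keys g"
  have "eval_poly5 (f + g) v = (\<Sum>m\<in>?A. Poly_Mapping.lookup (f + g) m *
      (\<Prod>i\<in>UNIV. v $ i ^ Poly_Mapping.lookup m i))"
    by (rule eval_poly5_superset) (simp_all add: Poly_Mapping.keys_add)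
  also have "\<dots> = eval_poly5 f v + eval_poly5 g v"
    using eval_poly5_superset[of ?A f v] eval_poly5_superset[of ?A g v]
    by (simp add: lookup_add distrib_right sum.distrib)
  finally show ?thesis .
qed

lemma eval_poly5_sum: "eval_poly5 (\<Sum>i\<in>I. f i) v = (\<Sum>i\<in>I. eval_poly5 (f i) v)"
  by (induction I rule: infinite_finite_induct) (simp_all add: eval_poly5_add, simp_all add: eval_poly5_def)

lemma forms2_add: "f \<in> forms2 \<Longrightarrow> g \<in> forms2 \<Longrightarrow> f + g \<in> forms2"
  using Poly_Mapping.keys_add[of f g] unfolding forms2_def by blast

lemma forms2_sum: "(\<And>i. i \<in> I \<Longrightarrow> f i \<in> forms2) \<Longrightarrow> (\<Sum>i\<in>I. f i) \<in> forms2"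
  by (induction I rule: infinite_finite_induct) (simp_all add: forms2_add, simp_all add: forms2_def)

lemma product_of_linear_forms:
  fixes a b :: "'a::field ^ 5"
  obtains f where "f \<in> forms2"
    "\<And>v. eval_poly5 f v = (\<Sum>i\<in>UNIV. a $ i * v $ i) * (\<Sum>j\<in>UNIV. b $ j * v $ j)"
proof
  let ?m = "\<lambda>i j :: 5. Poly_Mapping.single i (1::nat) + Poly_Mapping.single j 1"
  let ?f = "\<lambda>i j. Poly_Mapping.single (?m i j) (a $ i * b $ j)"
  show "(\<Sum>i\<in>UNIV. \<Sum>j\<in>UNIV. ?f i j) \<in> forms2"
    by (intro forms2_sum) (simp add: forms2_def lookup_add sum.distrib lookup_single when_def)
  fix v :: "'a ^ 5"
  have "(\<Prod>k\<in>UNIV. v $ k ^ Poly_Mapping.lookup (?m i j) k) = v $ i * v $ j" for i j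
  proof -
    have "(\<Prod>k\<in>UNIV. v $ k ^ Poly_Mapping.lookup (?m i j) k) =
        (\<Prod>k\<in>UNIV. if k = i then v $ k else 1) * (\<Prod>k\<in>UNIV. if k = j then v $ k else 1)"
      unfolding prod.distrib[symmetric]
      by (rule prod.cong) (auto simp: lookup_add lookup_single when_def)
    then show ?thesis by simp
  qed
  then have "eval_poly5 (?f i j) v = (a $ i * v $ i) * (b $ j * v $ j)" for i j
    using eval_poly5_superset[of "{?m i j}" "?f i j" v] by simp
  then show "eval_poly5 (\<Sum>i\<in>UNIV. \<Sum>j\<in>UNIV. ?f i j) v =
      (\<Sum>i\<in>UNIV. a $ i * v $ i) * (\<Sum>j\<in>UNIV. b $ j * v $ j)"
    by (simp add: eval_poly5_sum sum_product)
qed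

section \<open>Passage to projective space\<close>

text \<open>A cone: a set of vectors that is determined by the projective points it
  contains.\<close>

definition scaling_closed :: "('a::field ^ 5) set \<Rightarrow> bool" where
  "scaling_closed C \<longleftrightarrow> 0 \<in> C \<and> (\<forall>c. \<forall>v\<in>C. c *s v \<in> C)"

definition proj :: "('a::field ^ 5) set \<Rightarrow> ('a ^ 5) set set" where
  "proj C = {x \<in> PG4. x \<subseteq> C}"

lemma span_subset_iff: "scaling_closed C \<Longrightarrow> vec.span {v} \<subseteq> C \<longleftrightarrow> v \<in> C"
  using vec.span_base[of v "{v}"] by (auto simp: scaling_closed_def vec.span_singleton)

lemma span_in_proj_iff: "scaling_closed C \<Longrightarrow> v \<noteq> 0 \<Longrightarrow> vec.span {v} \<in> proj C \<longleftrightarrow> v \<in> C"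
  by (auto simp: proj_def PG4_def span_subset_iff)

lemma projE:
  assumes "x \<in> proj C"
  obtains v where "x = vec.span {v}" "v \<noteq> 0" "v \<in> C"
  using assms vec.span_base[of _ "{_}"] by (auto simp: proj_def PG4_def)

lemma proj_Int: "proj (C \<inter> D) = proj C \<inter> proj D"
  by (auto simp: proj_def)

lemma scaling_closed_Un: "scaling_closed C \<Longrightarrow> scaling_closed D \<Longrightarrow> scaling_closed (C \<union> D)"
  by (auto simp: scaling_closed_def)

lemma scaling_closed_subspace: "vec.subspace W \<Longrightarrow> scaling_closed W"
  by (auto simp: vec.subspace_def scaling_closed_def)

lemmas scaling_closed_perp = scaling_closed_subspace[OF subspace_perp]

lemma proj_Un:
  assumes "scaling_closed C" "scaling_closed D"
  shows "proj (C \<union> D) = proj C \<union> proj D"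
proof (intro set_eqI)
  fix x
  show "x \<in> proj (C \<union> D) \<longleftrightarrow> x \<in> proj C \<union> proj D"
  proof (cases "x \<in> PG4")
    case True
    then obtain v where v: "x = vec.span {v}" "v \<noteq> 0" by (auto simp: PG4_def)
    then show ?thesis
      using assms by (simp add: span_in_proj_iff scaling_closed_Un)
  qed (auto simp: proj_def)
qed

lemma proj_inject:
  assumes "scaling_closed C" "scaling_closed D" "proj C = proj D"
  shows "C = D"
proof (rule set_eqI)
  fix v
  show "v \<in> C \<longleftrightarrow> v \<in> D"
  proof (cases "v = 0")
    case True
    then show ?thesis using assms by (simp add: scaling_closed_def)
  next
    case False
    then show ?thesis using assms by (metis span_in_proj_iff)
  qed
qed

lemma span_Union_proj:
  assumes "vec.subspace W"
  shows "vec.span (\<Union> (proj W)) = W"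
proof
  have "\<Union> (proj W) \<subseteq> W" by (auto simp: proj_def)
  then show "vec.span (\<Union> (proj W)) \<subseteq> W"
    using assms by (rule vec.span_minimal)
  show "W \<subseteq> vec.span (\<Union> (proj W))"
  proof
    fix v assume v: "v \<in> W"
    show "v \<in> vec.span (\<Union> (proj W))"
    proof (cases "v = 0")
      case True
      then show ?thesis by (simp add: vec.span_zero)
    next
      case False
      then have "vec.span {v} \<in> proj W"
        using v assms by (simp add: span_in_proj_iff scaling_closed_subspace)
      moreover have "v \<in> vec.span {v}" by (simp add: vec.span_base)
      ultimately show ?thesis by (intro vec.span_base) auto
    qed
  qed
qed

text \<open>Each point carries CARD - 1 nonzero vectors, and the vector 0 belongs to no
  fibre.\<close>

lemma card_proj:
  fixes C :: "('a::{field,finite} ^ 5) set"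
  assumes C: "scaling_closed C"
  shows "(CARD('a) - 1) * card (proj C) = card C - 1"
proof -
  have fibre: "card {v \<in> C - {0}. vec.span {v} = x} = CARD('a) - 1" if x: "x \<in> proj C" for x
  proof -
    obtain u where u: "x = vec.span {u}" "u \<noteq> 0" "u \<in> C"
      using x by (rule projE)
    have span: "vec.span {c *s u} = vec.span {u}" if "c \<noteq> 0" for c
    proof -
      have "k *s u \<in> range (\<lambda>k. k *s (c *s u))" for k
        by (rule range_eqI[of _ _ "k / c"]) (use that in simp)
      moreover have "k *s (c *s u) \<in> range (\<lambda>k. k *s u)" for k
        by (rule range_eqI[of _ _ "k * c"]) simp
      ultimately show ?thesis unfolding vec.span_singleton by blast
    qed
    have "{v \<in> C - {0}. vec.span {v} = x} = (\<lambda>c. c *s u) ` (UNIV - {0})"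
    proof
      show "{v \<in> C - {0}. vec.span {v} = x} \<subseteq> (\<lambda>c. c *s u) ` (UNIV - {0})"
      proof
        fix v assume v: "v \<in> {v \<in> C - {0}. vec.span {v} = x}"
        then have "v \<in> vec.span {u}" using u vec.span_base[of v "{v}"] by auto
        then show "v \<in> (\<lambda>c. c *s u) ` (UNIV - {0})"
          using v by (auto simp: vec.span_singleton)
      qed
      show "(\<lambda>c. c *s u) ` (UNIV - {0}) \<subseteq> {v \<in> C - {0}. vec.span {v} = x}"
        using u C by (auto simp: span scaling_closed_def)
    qed
    moreover have "inj_on (\<lambda>c. c *s u) (UNIV - {0})"
      using u by (auto intro: inj_onI)
    ultimately show ?thesis by (simp add: card_image card_Diff_singleton)
  qed
  have "card (C - {0}) = (\<Sum>x\<in>proj C. card {v \<in> C - {0}. vec.span {v} = x})"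
    using sum.group[of "C - {0}" "proj C" "\<lambda>v. vec.span {v}" "\<lambda>_. 1::nat"] C
    by (simp add: image_subset_iff span_in_proj_iff)
  also have "\<dots> = (CARD('a) - 1) * card (proj C)"
    using fibre by simp
  finally show ?thesis
    using C by (simp add: scaling_closed_def)
qed

text \<open>Allows the dimension of an intersection of hyperplanes to be read off from its
  cardinality.\<close>

lemma card_subspace:
  fixes W :: "('a::{field,finite} ^ 5) set"
  assumes "vec.subspace W"
  shows "card W = CARD('a) ^ vec.dim W"
proof -
  have span: "card (vec.span B) = CARD('a) ^ card B" if "finite B" "vec.independent B" for B :: "('a ^ 5) set"
    using that
  proof (induction B rule: finite_induct)
    case (insert b B)
    have b: "b \<notin> vec.span B" and B: "vec.independent B"
      using insert by (auto simp: vec.independent_insert)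
    have "bij_betw (\<lambda>(c, x). c *s b + x) (UNIV \<times> vec.span B) (vec.span (insert b B))"
      unfolding bij_betw_def
    proof
      show "inj_on (\<lambda>(c, x). c *s b + x) (UNIV \<times> vec.span B)"
      proof (rule inj_onI, clarify)
        fix c d x y assume *: "x \<in> vec.span B" "y \<in> vec.span B" "c *s b + x = d *s b + y"
        then have eq: "(c - d) *s b = y - x"
          by (simp add: vec.scale_left_diff_distrib algebra_simps)
        have "c = d"
        proof (rule ccontr)
          assume "c \<noteq> d"
          then have "b = inverse (c - d) *s (y - x)"
            by (simp only: eq[symmetric] vec.scale_scale) simp
          then have "b \<in> vec.span B"
            using * by (metis vec.span_diff vec.span_scale)
          then show False using b by simp
        qed
        then show "c = d \<and> x = y" using *(3) by simp
      qed
      show "(\<lambda>(c, x). c *s b + x) ` (UNIV \<times> vec.span B) = vec.span (insert b B)"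
      proof
        show "(\<lambda>(c, x). c *s b + x) ` (UNIV \<times> vec.span B) \<subseteq> vec.span (insert b B)"
          using vec.span_mono[of B "insert b B"]
          by (auto intro!: vec.span_add vec.span_scale intro: vec.span_base)
        show "vec.span (insert b B) \<subseteq> (\<lambda>(c, x). c *s b + x) ` (UNIV \<times> vec.span B)"
        proof
          fix v assume "v \<in> vec.span (insert b B)"
          then obtain c where "v - c *s b \<in> vec.span B"
            by (auto simp: vec.span_insert)
          then show "v \<in> (\<lambda>(c, x). c *s b + x) ` (UNIV \<times> vec.span B)"
            by (intro image_eqI[of _ _ "(c, v - c *s b)"]) auto
        qed
      qed
    qed
    from bij_betw_same_card[OF this] show ?case
      using insert B by (simp add: card_cartesian_product)
  qed simp
  obtain B where B: "B \<subseteq> W" "vec.independent B" "W \<subseteq> vec.span B" "card B = vec.dim W"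
    using vec.basis_exists by blast
  then have "vec.span B = W"
    using assms by (simp add: subset_antisym vec.span_minimal)
  then show ?thesis using span[of B] B by simp
qed

lemma hermitian_variety_eq_proj: "hermitian_variety t = proj (isotropic t UNIV)"
  by (auto simp: hermitian_variety_def proj_def isotropic_def hermitian_form_def mult.commute)

lemma zero_set_eq_proj: "zero_set f = proj {v. eval_poly5 f v = 0}"
  by (auto simp: zero_set_def proj_def)

lemma scaling_closed_zeros: "f \<in> forms2 \<Longrightarrow> scaling_closed {v. eval_poly5 f v = 0}"
  using eval_poly5_scale[of f 0 0] by (simp add: scaling_closed_def eval_poly5_scale)

section \<open>Tangency, plane sections and weights in terms of vectors\<close>

context square_field
begin

lemma scaling_closed_isotropic: "scaling_closed (C :: ('a ^ 5) set) \<Longrightarrow> scaling_closed (isotropic t C)"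
  by (auto simp: scaling_closed_def isotropic_def h_self_scale)

text \<open>Conjugation is an involution, so every coefficient vector is the conjugate of some
  \<open>p\<close>.\<close>

lemma hyperplane_iff: "hyperplane (H :: ('a ^ 5) set set) \<longleftrightarrow> (\<exists>p. p \<noteq> 0 \<and> H = proj (perp t p))"
proof
  assume "hyperplane H"
  then obtain a where a: "a \<noteq> 0" "H = {x \<in> PG4. \<forall>v\<in>x. (\<Sum>i\<in>UNIV. a $ i * v $ i) = 0}"
    by (auto simp: hyperplane_def)
  let ?p = "(\<chi> i. a $ i ^ t) :: 'a ^ 5"
  have "?p \<noteq> 0" using a(1) by (auto simp: vec_eq_iff)
  moreover have "H = proj (perp t ?p)"
    unfolding a(2) by (auto simp: proj_def perp_def hermitian_form_def)
  ultimately show "\<exists>p. p \<noteq> 0 \<and> H = proj (perp t p)" by blast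
next
  assume "\<exists>p. p \<noteq> 0 \<and> H = proj (perp t p)"
  then obtain p where p: "p \<noteq> 0" "H = proj (perp t p)" by blast
  let ?a = "(\<chi> i. p $ i ^ t) :: 'a ^ 5"
  have "?a \<noteq> 0" using p(1) by (auto simp: vec_eq_iff)
  moreover have "H = {x \<in> PG4. \<forall>v\<in>x. (\<Sum>i\<in>UNIV. ?a $ i * v $ i) = 0}"
    unfolding p(2) by (auto simp: proj_def perp_def hermitian_form_def)
  ultimately show "hyperplane H" unfolding hyperplane_def by blast
qed

lemma tangent_at_span: "tangent_at t (vec.span {p}) = proj (perp t (p :: 'a ^ 5))"
proof -
  have "(\<forall>c. h (c *s p) v = 0) \<longleftrightarrow> h p v = 0" for v
    by (metis h_scale_left mult_zero_right vec.scale_one)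
  then show ?thesis
    unfolding tangent_at_def proj_def perp_def vec.span_singleton hermitian_form_def[symmetric]
    by auto
qed

lemma tangent_hyperplane_iff:
  "tangent_hyperplane t (H :: ('a ^ 5) set set) \<longleftrightarrow> (\<exists>p. p \<noteq> 0 \<and> h p p = 0 \<and> H = proj (perp t p))"
proof
  assume "tangent_hyperplane t H"
  then obtain P where "P \<in> proj (isotropic t UNIV)" "H = tangent_at t P"
    by (auto simp: tangent_hyperplane_def hermitian_variety_eq_proj)
  then show "\<exists>p. p \<noteq> 0 \<and> h p p = 0 \<and> H = proj (perp t p)"
    by (auto elim!: projE simp: tangent_at_span isotropic_def)
next
  assume "\<exists>p. p \<noteq> 0 \<and> h p p = 0 \<and> H = proj (perp t p)"
  then obtain p where p: "p \<noteq> 0" "h p p = 0" "H = proj (perp t p)" by blast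
  then have "vec.span {p} \<in> hermitian_variety t"
    unfolding hermitian_variety_eq_proj
    by (subst span_in_proj_iff) (auto simp: isotropic_def scaling_closed_def h_self_scale)
  then show "tangent_hyperplane t H"
    unfolding tangent_hyperplane_def p(3) tangent_at_span[symmetric] by blast
qed

text \<open>An isotropic vector defining the same hyperplane is excluded by counting: the numbers of
  isotropic vectors of the two kinds of hyperplanes differ.\<close>

lemma nontangent_hyperplane:
  assumes p: "h p p \<noteq> 0"
  shows "\<not> tangent_hyperplane t (proj (perp t p))"
proof
  assume "tangent_hyperplane t (proj (perp t p))"
  then obtain r where r: "r \<noteq> 0" "h r r = 0" "proj (perp t p) = proj (perp t r)"
    by (auto simp: tangent_hyperplane_iff)
  then have "perp t p = perp t r"
    by (intro proj_inject scaling_closed_perp)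
  moreover have "t ^ 3 < t ^ 5" using t_ge_2 by (intro power_strict_increasing) auto
  ultimately show False
    using card_isotropic_nontangent[OF p] card_isotropic_tangent[OF r(2,1)] by simp
qed

text \<open>If \<open>ortho p p'\<close> is isotropic, it is a nonzero vector of the plane
  orthogonal to the whole plane. Otherwise \<open>p\<close> and \<open>ortho p p'\<close> are
  orthogonal and anisotropic, so the space is the orthogonal sum of their lines and the plane, and
  the plane inherits nondegeneracy.\<close>

lemma nonsingular_section_iff:
  assumes p: "h p p \<noteq> 0" and u: "u \<in> perp t p" "u \<notin> perp t p'"
  shows "nonsingular_section t (proj (perp t p) \<inter> proj (perp t p')) \<longleftrightarrow>
    h (ortho p p') (ortho p p') \<noteq> 0"
proof -
  let ?r = "ortho p p'" and ?W = "perp t p \<inter> perp t p'"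
  have W: "vec.subspace ?W"
    by (intro vec.subspace_inter subspace_perp)
  have W_r: "?W = perp t p \<inter> perp t ?r"
    by (simp add: perp_Int_perp_ortho)
  have "p \<noteq> 0" using p by auto
  then have "(t\<^sup>2) ^ 3 = (t\<^sup>2) ^ vec.dim ?W"
    using card_perp_Int_perp[OF _ u] card_subspace[OF W] by (simp add: card_field flip: power_mult)
  moreover have "t\<^sup>2 > 1" by (rule one_less_power) (use t_ge_2 in auto)
  ultimately have dim: "vec.dim ?W = 3" by (simp only: power_inject_exp)
  let ?R = "{v \<in> ?W. \<forall>u\<in>?W. h u v = 0}"
  have R: "vec.subspace ?R"
    using W by (auto simp: vec.subspace_def h_linear)
  have "nonsingular_section t (proj (perp t p) \<inter> proj (perp t p')) \<longleftrightarrow> 3 - vec.dim ?R = 3"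
    by (simp add: nonsingular_section_def hermitian_rank_def span_Union_proj[OF W] dim flip: proj_Int)
  also have "\<dots> \<longleftrightarrow> vec.dim ?R = 0" by arith
  also have "\<dots> \<longleftrightarrow> ?R \<subseteq> {0}" by (rule vec.dim_eq_0)
  also have "\<dots> \<longleftrightarrow> ?R = {0}" using vec.subspace_0[OF R] by blast
  also have "\<dots> \<longleftrightarrow> h ?r ?r \<noteq> 0"
  proof
    assume R0: "?R = {0}"
    show "h ?r ?r \<noteq> 0"
    proof
      assume r: "h ?r ?r = 0"
      then have "?r \<in> ?W" unfolding W_r using ortho_in_perp[OF p] by (simp add: perp_def)
      moreover have "h v ?r = 0" if "v \<in> ?W" for v
        using that unfolding W_r by (simp add: perp_def h_eq_0_commute[of ?r v])
      ultimately have "?r \<in> ?R" by blast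
      then have "?r = 0" using R0 by blast
      then show False using W_r u by (auto simp: perp_def)
    qed
  next
    assume r: "h ?r ?r \<noteq> 0"
    have "v = 0" if v: "v \<in> ?R" for v
    proof (rule h_nondegenerate)
      fix y
      \<comment> \<open>Two Gram-Schmidt steps move \<open>y\<close> into the plane, subtracting
        only vectors orthogonal to \<open>v\<close>.\<close>
      define y1 where "y1 = y - (h p y / h p p) *s p"
      define y2 where "y2 = y1 - (h ?r y1 / h ?r ?r) *s ?r"
      have pr: "h p ?r = 0" using ortho_in_perp[OF p] by (simp add: perp_def)
      have "h p y1 = 0" using p by (simp add: y1_def h_linear)
      then have "y2 \<in> ?W" unfolding W_r using r pr by (simp add: perp_def y2_def h_linear)
      then have "h v y2 = 0" using v h_eq_0_commute by blast
      moreover have "v \<in> perp t p \<inter> perp t ?r" using v W_r by blast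
      then have "h v p = 0" "h v ?r = 0"
        using h_eq_0_commute by (auto simp: perp_def)
      ultimately show "h v y = 0" by (simp add: y2_def y1_def h_linear)
    qed
    then show "?R = {0}" using vec.subspace_0[OF R] by blast
  qed
  finally show ?thesis .
qed

text \<open>The weight is a difference of two numbers of points; after multiplication by t^2 - 1 the
  contributions of the zero vector cancel.\<close>

lemma weight_eq:
  fixes f :: "'a poly5"
  assumes f: "f \<in> forms2"
  shows "(int t ^ 2 - 1) * int (weight t (codeword t f)) +
    int (card (isotropic t {v. eval_poly5 f v = 0})) = int t ^ 9 + int t ^ 4 - int t ^ 5"
proof -
  let ?Z = "{v. eval_poly5 f v = 0}"
  note closed = scaling_closed_zeros[OF f]
  have sc: "scaling_closed (UNIV :: ('a ^ 5) set)" by (simp add: scaling_closed_def)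
  have X: "hermitian_variety t \<inter> zero_set f = proj (isotropic t ?Z)"
    unfolding hermitian_variety_eq_proj zero_set_eq_proj proj_Int[symmetric]
    by (rule arg_cong[of _ _ proj]) (auto simp: isotropic_def)
  have pos: "t\<^sup>2 \<ge> 1" by (simp add: Suc_leI)
  have card: "(int t ^ 2 - 1) * int (card (proj (isotropic t C))) = int (card (isotropic t C)) - 1"
    if C: "scaling_closed C" for C :: "('a ^ 5) set"
  proof -
    have iso: "scaling_closed (isotropic t C)" by (rule scaling_closed_isotropic[OF C])
    then have "isotropic t C \<noteq> {}" by (auto simp: scaling_closed_def)
    then have "card (isotropic t C) \<ge> 1" by (simp add: Suc_leI card_gt_0_iff)
    moreover have "int ((t\<^sup>2 - 1) * card (proj (isotropic t C))) = int (card (isotropic t C) - 1)"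
      using card_proj[OF iso] by (simp add: card_field)
    ultimately show ?thesis using pos by (simp add: of_nat_diff)
  qed
  have "card (proj (isotropic t ?Z)) \<le> card (proj (isotropic t (UNIV :: ('a ^ 5) set)))"
    by (intro card_mono) (auto simp: proj_def isotropic_def)
  then have "int (weight t (codeword t f)) =
      int (card (proj (isotropic t (UNIV :: ('a ^ 5) set)))) - int (card (proj (isotropic t ?Z)))"
    by (simp add: weight_codeword[OF f] X) (simp add: hermitian_variety_eq_proj of_nat_diff)
  then have "(int t ^ 2 - 1) * int (weight t (codeword t f)) =
      int (card (isotropic t (UNIV :: ('a ^ 5) set))) - int (card (isotropic t ?Z))"
    using card[OF sc] card[OF closed] by (simp add: right_diff_distrib)
  moreover have "int (card (isotropic t (UNIV :: ('a ^ 5) set)) + t ^ 5) = int (t ^ 9 + t ^ 4)"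
    by (simp only: card_isotropic_UNIV)
  ultimately show ?thesis by simp
qed

end

section \<open>The low weights\<close>

context square_field
begin

text \<open>Ensures that the natural-number subtractions in the weights are not truncated.\<close>

lemma powers_less: "t ^ 5 + t ^ 3 + t\<^sup>2 < t ^ 7" and power_2_le_4: "t\<^sup>2 < t ^ 4"
proof -
  have "t ^ 3 < t ^ 5" "t\<^sup>2 < t ^ 5"
    using t_ge_2 by (auto intro: power_strict_increasing)
  moreover have "2 * 2 * t ^ 5 \<le> t * t * t ^ 5"
    using t_ge_2 by (intro mult_le_mono) auto
  then have "4 * t ^ 5 \<le> t ^ 7" by (simp add: eval_nat_numeral)
  ultimately show "t ^ 5 + t ^ 3 + t\<^sup>2 < t ^ 7" by linarith
  show "t\<^sup>2 < t ^ 4" using t_ge_2 by (auto intro: power_strict_increasing)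
qed

lemma int_weights:
  "int (t ^ 7 - t ^ 5 - t ^ 3 - t\<^sup>2) = int t ^ 7 - int t ^ 5 - int t ^ 3 - int t ^ 2"
  "int (t ^ 7 - t ^ 5 - t ^ 3) = int t ^ 7 - int t ^ 5 - int t ^ 3"
  "int (t ^ 7 - t ^ 5 - t\<^sup>2) = int t ^ 7 - int t ^ 5 - int t ^ 2"
  using powers_less by (simp_all add: of_nat_diff)

lemma weight_eqI:
  fixes f :: "'a poly5"
  assumes "f \<in> forms2"
    and "int (card (isotropic t {v. eval_poly5 f v = 0})) =
      int t ^ 9 + int t ^ 4 - int t ^ 5 - (int t ^ 2 - 1) * int n"
  shows "weight t (codeword t f) = n"
proof -
  have "(int t ^ 2 - 1) * int (weight t (codeword t f)) = (int t ^ 2 - 1) * int n"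
    using weight_eq[OF assms(1)] assms(2) by linarith
  moreover have "int t ^ 2 \<noteq> 1" using t_ge_2 by (simp add: power2_eq_1_iff)
  ultimately show ?thesis by simp
qed

text \<open>Fewer isotropic vectors on the quadric mean a larger weight; equality in the assumption
  would correspond to weight exactly t^7 - t^5 - t^2.\<close>

lemma weight_gtI:
  fixes f :: "'a poly5"
  assumes "f \<in> forms2"
    and "card (isotropic t {v. eval_poly5 f v = 0}) + 2 * t ^ 5 + t\<^sup>2 < 2 * t ^ 7 + 2 * t ^ 4"
  shows "t ^ 7 - t ^ 5 - t\<^sup>2 < weight t (codeword t f)"
proof -
  have "int (card (isotropic t {v. eval_poly5 f v = 0}) + 2 * t ^ 5 + t\<^sup>2) < int (2 * t ^ 7 + 2 * t ^ 4)"
    using assms(2) by (simp only: of_nat_less_iff)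
  then have "int (card (isotropic t {v. eval_poly5 f v = 0})) <
      int t ^ 9 + int t ^ 4 - int t ^ 5 - (int t ^ 2 - 1) * (int t ^ 7 - int t ^ 5 - int t ^ 2)"
    by (simp add: algebra_simps flip: power_add)
  then have "(int t ^ 2 - 1) * (int t ^ 7 - int t ^ 5 - int t ^ 2) <
      (int t ^ 2 - 1) * int (weight t (codeword t f))"
    using weight_eq[OF assms(1)] by linarith
  moreover have "int t ^ 2 - 1 > 0"
  proof -
    have "1 < int t ^ 2" using t_ge_2 by (intro one_less_power) auto
    then show ?thesis by simp
  qed
  ultimately have "int (t ^ 7 - t ^ 5 - t\<^sup>2) < int (weight t (codeword t f))"
    unfolding int_weights by (simp only: mult_less_cancel_left_pos)
  then show ?thesis by simp
qed

context
  fixes f :: "'a poly5" and p p' u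
  assumes f: "f \<in> forms2" and zeros: "{v. eval_poly5 f v = 0} = perp t p \<union> perp t p'"
    and u: "u \<in> perp t p" "u \<notin> perp t p'"
begin

lemma weight_nontangent_pair:
  assumes "h p p \<noteq> 0" "h p' p' \<noteq> 0"
  shows "weight t (codeword t f) =
    (if h (ortho p p') (ortho p p') = 0 then t ^ 7 - t ^ 5 - t ^ 3 else t ^ 7 - t ^ 5 - t ^ 3 - t\<^sup>2)"
proof -
  let ?A = "card (isotropic t (perp t p \<union> perp t p'))" and ?d = "if h (ortho p p') (ortho p p') = 0 then t ^ 4 else t\<^sup>2"
  have "?A + t ^ 5 + t ^ 3 + ?d = 2 * t ^ 7 + 2 * t ^ 4"
    using card_isotropic_pair_nontangent[OF assms u] power_2_le_4 by (auto split: if_splits)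
  then have "int (?A + t ^ 5 + t ^ 3 + ?d) = int (2 * t ^ 7 + 2 * t ^ 4)"
    by (simp only:)
  then have A: "int ?A = 2 * int t ^ 7 + 2 * int t ^ 4 - int t ^ 5 - int t ^ 3 - int ?d"
    by (simp only: of_nat_add of_nat_mult of_nat_power of_nat_numeral)
  show ?thesis
  proof (cases "h (ortho p p') (ortho p p') = 0")
    case True
    show ?thesis unfolding if_P[OF True]
      by (rule weight_eqI[OF f], simp only: zeros A int_weights if_P[OF True],
          simp add: algebra_simps flip: power_add)
  next
    case False
    show ?thesis unfolding if_not_P[OF False]
      by (rule weight_eqI[OF f], simp only: zeros A int_weights if_not_P[OF False],
          simp add: algebra_simps flip: power_add)
  qed
qed

text \<open>A singular plane section brings t^4 in place of t^2 into the count, so the union has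
  fewer isotropic vectors and the weight grows.\<close>

lemma weight_tangent_pair:
  assumes p: "h p p \<noteq> 0" and p': "h p' p' = 0" "p' \<noteq> 0"
  shows "h (ortho p p') (ortho p p') \<noteq> 0 \<Longrightarrow> weight t (codeword t f) = t ^ 7 - t ^ 5 - t\<^sup>2"
    and "h (ortho p p') (ortho p p') = 0 \<Longrightarrow> t ^ 7 - t ^ 5 - t\<^sup>2 < weight t (codeword t f)"
proof -
  let ?A = "card (isotropic t (perp t p \<union> perp t p'))"
  note card = card_isotropic_pair_tangent_nontangent[OF p p' u]
  {
    assume "h (ortho p p') (ortho p p') \<noteq> 0"
    then have "?A + 2 * t ^ 5 + t\<^sup>2 = 2 * t ^ 7 + 2 * t ^ 4"
      using card power_2_le_4 by simp
    then have "int (?A + 2 * t ^ 5 + t\<^sup>2) = int (2 * t ^ 7 + 2 * t ^ 4)"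
      by (simp only:)
    then have A: "int ?A = 2 * int t ^ 7 + 2 * int t ^ 4 - 2 * int t ^ 5 - int t ^ 2"
      by simp
    show "weight t (codeword t f) = t ^ 7 - t ^ 5 - t\<^sup>2"
      by (rule weight_eqI[OF f], simp only: zeros A int_weights,
          simp add: algebra_simps flip: power_add)
  }
  assume "h (ortho p p') (ortho p p') = 0"
  then have "?A + 2 * t ^ 5 + t\<^sup>2 < 2 * t ^ 7 + 2 * t ^ 4"
    using card power_2_le_4 by simp
  then show "t ^ 7 - t ^ 5 - t\<^sup>2 < weight t (codeword t f)"
    by (intro weight_gtI[OF f]) (simp only: zeros)
qed

lemma weight_tangent_tangent_pair:
  assumes "h p p = 0" "p \<noteq> 0" "h p' p' = 0" "p' \<noteq> 0"
  shows "t ^ 7 - t ^ 5 - t\<^sup>2 < weight t (codeword t f)"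
  using card_isotropic_pair_tangent[OF assms u] by (intro weight_gtI[OF f]) (simp only: zeros)

end

lemma low_weight_cases:
  fixes f :: "'a poly5"
  assumes f: "f \<in> forms2" and le: "weight t (codeword t f) \<le> t ^ 7 - t ^ 5 - t\<^sup>2"
  obtains (zero) "\<And>v. eval_poly5 f v = 0"
  | (first) "weight t (codeword t f) = t ^ 7 - t ^ 5 - t ^ 3 - t\<^sup>2"
  | (second) "weight t (codeword t f) = t ^ 7 - t ^ 5 - t ^ 3"
  | (third) p p' u where "weight t (codeword t f) = t ^ 7 - t ^ 5 - t\<^sup>2"
      "{v. eval_poly5 f v = 0} = perp t p \<union> perp t p'" "h p p \<noteq> 0" "h p' p' = 0" "p' \<noteq> 0"
      "u \<in> perp t p" "u \<notin> perp t p'" "h (ortho p p') (ortho p p') \<noteq> 0"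
proof -
  interpret quadric_section t field_type "eval_poly5 f"
    by (intro quadric_section.intro quadric_section_axioms.intro square_field_axioms
        quadratic_form_eval[OF f])
  have Z: "F.zeros UNIV = {v. eval_poly5 f v = 0}"
    by (simp add: F.zeros_def)
  \<comment> \<open>Proved once for \<open>p\<close> non-tangent and \<open>p'\<close> tangent; the
    opposite order is obtained by exchanging the hyperplanes, with \<open>u'\<close> for
    \<open>u\<close>.\<close>
  have mixed: thesis
    if "{v. eval_poly5 f v = 0} = perp t p \<union> perp t p'" "u \<in> perp t p" "u \<notin> perp t p'"
      "h p p \<noteq> 0" "h p' p' = 0" "p' \<noteq> 0" for p p' u
  proof (cases "h (ortho p p') (ortho p p') = 0")
    case True
    then show ?thesis using weight_tangent_pair(2)[OF f that] le by simp
  next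
    case False
    then show ?thesis using weight_tangent_pair(1)[OF f that] that third by blast
  qed
  show thesis
  proof (rule quadric_trichotomy)
    show thesis if "\<And>x. eval_poly5 f x = 0"
      using that by (rule zero)
    show thesis if "card (F.zeros UNIV) \<le> t ^ 8 + t ^ 6"
      using weight_gtI[OF f] card_isotropic_quadric_bound[OF that] le by (simp add: Z)
    fix p p' u u'
    assume pair: "F.zeros UNIV = perp t p \<union> perp t p'"
      and u: "u \<in> perp t p" "u \<notin> perp t p'" and u': "u' \<in> perp t p'" "u' \<notin> perp t p"
    note zeros = pair[unfolded Z]
    have zeros': "{v. eval_poly5 f v = 0} = perp t p' \<union> perp t p"
      using zeros by blast
    have nz: "p \<noteq> 0" "p' \<noteq> 0" using u u' by (auto simp: perp_def)
    consider "h p p \<noteq> 0" "h p' p' \<noteq> 0" | "h p p \<noteq> 0" "h p' p' = 0"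
      | "h p p = 0" "h p' p' \<noteq> 0" | "h p p = 0" "h p' p' = 0" by blast
    then show thesis
    proof cases
      case 1
      from weight_nontangent_pair[OF f zeros u this] show ?thesis
        using first second by (auto split: if_splits)
    next
      case 2
      then show ?thesis using mixed[OF zeros u] nz by blast
    next
      case 3
      then show ?thesis using mixed[OF zeros' u'] nz by blast
    next
      case 4
      then show ?thesis using weight_tangent_tangent_pair[OF f zeros u] nz le by simp
    qed
  qed
qed

lemma weight_zero_word: "weight t (zero_word t :: ('a ^ 5) set \<Rightarrow> 'a) = 0"
  by (simp add: weight_def zero_word_def)

lemma codeword_eq_zero_word:
  fixes f :: "'a poly5"
  assumes f: "f \<in> forms2" and zero: "\<And>v. eval_poly5 f v = 0"
  shows "codeword t f = zero_word t"
  unfolding codeword_def zero_word_def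
proof (rule restrict_ext)
  fix x :: "('a ^ 5) set" assume "x \<in> hermitian_variety t"
  then have "x \<in> PG4" by (simp add: hermitian_variety_def)
  then show "code_value f x = 0"
    using code_value_eq_0_iff[OF f] zero by (simp add: zero_set_def)
qed

section \<open>Existence of forms with the three smallest weights\<close>

lemma product_form:
  fixes p p' :: "'a ^ 5"
  obtains f where "f \<in> forms2" "{v. eval_poly5 f v = 0} = perp t p \<union> perp t p'"
proof -
  obtain f where f: "f \<in> forms2" "\<And>v. eval_poly5 f v =
      (\<Sum>i\<in>UNIV. (\<chi> i. p $ i ^ t) $ i * v $ i) * (\<Sum>j\<in>UNIV. (\<chi> i. p' $ i ^ t) $ j * v $ j)"
    using product_of_linear_forms by blast
  then have "{v. eval_poly5 f v = 0} = perp t p \<union> perp t p'"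
    by (auto simp: perp_def hermitian_form_def)
  then show thesis using f(1) that by blast
qed

text \<open>Two orthogonal unit vectors give the first weight. For \<open>c\<close> of norm -1, the
  vector \<open>?e j + c *s ?e k\<close> is isotropic: adding \<open>?e i\<close> gives a
  non-tangent hyperplane with singular plane section, hence the second weight. For the third,
  \<open>?e i + c *s ?e j\<close> is isotropic, but its part orthogonal to \<open>?e i\<close> is
  not.\<close>

lemma low_weights_attained:
  "\<exists>f \<in> (forms2 :: 'a poly5 set). weight t (codeword t f) = t ^ 7 - t ^ 5 - t ^ 3 - t\<^sup>2"
  "\<exists>f \<in> (forms2 :: 'a poly5 set). weight t (codeword t f) = t ^ 7 - t ^ 5 - t ^ 3"
  "\<exists>f \<in> (forms2 :: 'a poly5 set). weight t (codeword t f) = t ^ 7 - t ^ 5 - t\<^sup>2"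
proof -
  let ?e = "\<lambda>i :: 5. axis i (1 :: 'a)"
  obtain I :: "5 set" where "card I = 3"
    using obtain_subset_with_card_n[of 3 "UNIV :: 5 set"] by auto
  then obtain i j k :: 5 where ij: "i \<noteq> j" "j \<noteq> k" "i \<noteq> k"
    by (auto simp: card_3_iff)
  have e: "h (?e i) (?e j) = (if i = j then 1 else 0)" for i j
    by (simp only: h_axis) (simp add: axis_def)
  have "card {x :: 'a. x ^ t * x = - 1} = t + 1"
    by (intro card_norm_fibre K_minus K_1) simp
  then have "{x :: 'a. x ^ t * x = - 1} \<noteq> {}" by (metis Zero_not_Suc Suc_eq_plus1 card.empty)
  then obtain c :: 'a where c: "c ^ t * c = - 1" by blast
  then have c0: "c \<noteq> 0" by auto
  note simps = e ij ij[symmetric] h_linear ortho_def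
  have u: "?e j \<in> perp t (?e i)" by (simp add: perp_def e ij)
  show "\<exists>f \<in> (forms2 :: 'a poly5 set). weight t (codeword t f) = t ^ 7 - t ^ 5 - t ^ 3 - t\<^sup>2"
  proof -
    obtain f :: "'a poly5" where f: "f \<in> forms2" "{v. eval_poly5 f v = 0} = perp t (?e i) \<union> perp t (?e j)"
      by (rule product_form)
    have "?e j \<notin> perp t (?e j)" by (simp add: perp_def e)
    from weight_nontangent_pair[OF f u this] show ?thesis
      using f(1) by (auto simp: simps)
  qed
  show "\<exists>f \<in> (forms2 :: 'a poly5 set). weight t (codeword t f) = t ^ 7 - t ^ 5 - t ^ 3"
  proof -
    let ?p = "?e i + (?e j + c *s ?e k)"
    obtain f :: "'a poly5" where f: "f \<in> forms2" "{v. eval_poly5 f v = 0} = perp t (?e i) \<union> perp t ?p"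
      by (rule product_form)
    have u': "?e j \<notin> perp t ?p" by (simp add: perp_def simps)
    have "h ?p ?p \<noteq> 0" "ortho (?e i) ?p = ?e j + c *s ?e k" "h (?e j + c *s ?e k) (?e j + c *s ?e k) = 0"
      using c by (simp_all add: simps mult.commute)
    then show ?thesis
      using weight_nontangent_pair[OF f u u'] f(1) by (auto simp: e)
  qed
  show "\<exists>f \<in> (forms2 :: 'a poly5 set). weight t (codeword t f) = t ^ 7 - t ^ 5 - t\<^sup>2"
  proof -
    let ?p = "?e i + c *s ?e j"
    obtain f :: "'a poly5" where f: "f \<in> forms2" "{v. eval_poly5 f v = 0} = perp t (?e i) \<union> perp t ?p"
      by (rule product_form)
    have u': "?e j \<notin> perp t ?p" using c0 by (simp add: perp_def simps)
    have "h ?p ?p = 0" "ortho (?e i) ?p = c *s ?e j" "h (c *s ?e j) (c *s ?e j) \<noteq> 0"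
      using c by (simp_all add: simps mult.commute)
    moreover have "?p \<noteq> 0" using u' by (auto simp: perp_def)
    ultimately show ?thesis
      using weight_tangent_pair(1)[OF f u u'] f(1) by (auto simp: e)
  qed
qed

lemma third_weight: "is_nth_smallest (weights TYPE('a) t) 3 (t ^ 7 - t ^ 5 - t\<^sup>2)"
proof -
  let ?w1 = "t ^ 7 - t ^ 5 - t ^ 3 - t\<^sup>2" and ?w2 = "t ^ 7 - t ^ 5 - t ^ 3" and ?w3 = "t ^ 7 - t ^ 5 - t\<^sup>2"
  have "t\<^sup>2 < t ^ 3" "0 < t\<^sup>2"
    using t_ge_2 by (auto intro: power_strict_increasing)
  then have less: "0 < ?w1" "?w1 < ?w2" "?w2 < ?w3"
    using powers_less by linarith+
  \<comment> \<open>A word of positive weight cannot be the zero word.\<close>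
  have attained: "n \<in> weights TYPE('a) t"
    if n: "\<exists>f \<in> (forms2 :: 'a poly5 set). weight t (codeword t f) = n" "n > 0" for n
  proof -
    obtain f :: "'a poly5" where f: "f \<in> forms2" "weight t (codeword t f) = n"
      using n by blast
    then have "codeword t f \<noteq> zero_word t"
      using n(2) weight_zero_word by auto
    then show ?thesis
      using f unfolding weights_def functional_code_def by blast
  qed
  have in_w: "?w1 \<in> weights TYPE('a) t" "?w2 \<in> weights TYPE('a) t" "?w3 \<in> weights TYPE('a) t"
    by (rule attained[OF low_weights_attained(1) less(1)],
        rule attained[OF low_weights_attained(2)], use less in linarith,
        rule attained[OF low_weights_attained(3)], use less in linarith)
  have "{n \<in> weights TYPE('a) t. n < ?w3} = {?w1, ?w2}"
  proof
    show "{?w1, ?w2} \<subseteq> {n \<in> weights TYPE('a) t. n < ?w3}"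
      using in_w less by auto
    show "{n \<in> weights TYPE('a) t. n < ?w3} \<subseteq> {?w1, ?w2}"
    proof
      fix n assume n: "n \<in> {n \<in> weights TYPE('a) t. n < ?w3}"
      then obtain f :: "'a poly5" where f: "f \<in> forms2" "codeword t f \<noteq> zero_word t"
        "n = weight t (codeword t f)"
        by (auto simp: weights_def functional_code_def)
      have le: "weight t (codeword t f) \<le> ?w3" using n f(3) by simp
      show "n \<in> {?w1, ?w2}"
        using f(1) le
      proof (cases rule: low_weight_cases)
        case zero
        then show ?thesis using codeword_eq_zero_word f by blast
      qed (use n f(3) in auto)
    qed
  qed
  then show ?thesis
    using in_w less by (simp add: is_nth_smallest_def)
qed

lemma third_weight_codewords:
  fixes f :: "'a poly5"
  assumes f: "f \<in> forms2"
  shows "weight t (codeword t f) = t ^ 7 - t ^ 5 - t\<^sup>2 \<longleftrightarrow>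
       (\<exists>H K. hyperplane H \<and> hyperplane K \<and>
          zero_set f = H \<union> K \<and>
          tangent_hyperplane t H \<and> \<not> tangent_hyperplane t K \<and>
          nonsingular_section t (H \<inter> K))"
    (is "?w = ?w3 \<longleftrightarrow> ?R")
proof
  have "t\<^sup>2 < t ^ 3" using t_ge_2 by (auto intro: power_strict_increasing)
  then have less: "0 < ?w3" "t ^ 7 - t ^ 5 - t ^ 3 < ?w3" "t ^ 7 - t ^ 5 - t ^ 3 - t\<^sup>2 < ?w3"
    using powers_less by linarith+
  assume w: "?w = ?w3"
  then have "?w \<le> ?w3" by simp
  with f show ?R
  proof (cases rule: low_weight_cases)
    case zero
    then have "?w = 0" using codeword_eq_zero_word[OF f] weight_zero_word by metis
    then show ?thesis using w less by simp
  next
    case (third p p' u)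
    have "p \<noteq> 0" using third by auto
    have zeros: "zero_set f = proj (perp t p') \<union> proj (perp t p)"
      using third by (simp add: zero_set_eq_proj proj_Un scaling_closed_perp Un_commute)
    have "nonsingular_section t (proj (perp t p') \<inter> proj (perp t p))"
      using nonsingular_section_iff[of p u p'] third by (simp add: Int_commute)
    then show ?thesis
      using third \<open>p \<noteq> 0\<close> zeros nontangent_hyperplane[of p] hyperplane_iff tangent_hyperplane_iff by metis
  qed (use w less in auto)
next
  assume ?R
  then obtain H K where HK: "hyperplane K" "zero_set f = H \<union> K" "tangent_hyperplane t H"
    "\<not> tangent_hyperplane t K" "nonsingular_section t (H \<inter> K)" by blast
  obtain p' where p': "p' \<noteq> 0" "h p' p' = 0" "H = proj (perp t p')"
    using HK(3) tangent_hyperplane_iff by blast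
  obtain p where p: "p \<noteq> 0" "K = proj (perp t p)"
    using HK(1) hyperplane_iff by blast
  have hp: "h p p \<noteq> 0" using HK(4) p tangent_hyperplane_iff by blast
  \<comment> \<open>Both hyperplanes have t^8 vectors, so an inclusion would be an equality,
    although only one of them is tangent.\<close>
  have "\<not> perp t p \<subseteq> perp t p'"
  proof
    assume "perp t p \<subseteq> perp t p'"
    then have "perp t p = perp t p'"
      using p(1) p'(1) by (intro card_subset_eq) (simp_all add: card_perp)
    then show False using HK(3,4) p p' by simp
  qed
  then obtain u where u: "u \<in> perp t p" "u \<notin> perp t p'" by blast
  have "proj {v. eval_poly5 f v = 0} = proj (perp t p \<union> perp t p')"
    using HK(2) p p' by (simp add: zero_set_eq_proj proj_Un scaling_closed_perp Un_commute)
  then have zeros: "{v. eval_poly5 f v = 0} = perp t p \<union> perp t p'"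
    by (intro proj_inject scaling_closed_zeros[OF f] scaling_closed_Un scaling_closed_perp)
  have "h (ortho p p') (ortho p p') \<noteq> 0"
    using nonsingular_section_iff[OF hp u] HK(5) p p' by (simp add: Int_commute)
  then show "?w = ?w3"
    using weight_tangent_pair(1)[OF f zeros u hp p'(2,1)] by blast
qed

end

theorem theorem6p6:
  fixes t :: nat
  assumes "primepow t"
    and "CARD('a::{field,finite}) = t\<^sup>2"
  shows "is_nth_smallest (weights TYPE('a) t) 3 (t ^ 7 - t ^ 5 - t ^ 2) \<and>
    (\<forall>f \<in> (forms2 :: 'a poly5 set).
       weight t (codeword t f) = t ^ 7 - t ^ 5 - t ^ 2 \<longleftrightarrow>
       (\<exists>H K. hyperplane H \<and> hyperplane K \<and>
          zero_set f = H \<union> K \<and>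
          tangent_hyperplane t H \<and> \<not> tangent_hyperplane t K \<and>
          nonsingular_section t (H \<inter> K)))"
proof -
  interpret square_field t "TYPE('a)"
    using assms by unfold_locales
  show ?thesis
    using third_weight third_weight_codewords by blast
qed

end
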